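(* Let $n_1,\dots,n_d\in\mathbb{N}$ and $z_1,\dots,z_{d-1}\in\mathbb{C}_\infty$. Then: (1) If $z_d\in\mathbb{C}_\infty$ and $(z_1,\dots,z_d)\in\mathbb{D}$, then $\vec{\mathrm{Li}}_{n_1,\dots,n_d}(z_1,\dots,z_d)$ is congruent modulo $M^{z_1,\dots,z_{d-1}}_{n_1,\dots,n_d}$ to $\big(\tilde\pi^{n_1+\dots+n_{d-1}}\mathrm{Li}_{n_d}(z_d),\dots,\tilde\pi^{n_1}\mathrm{Li}_{n_2,\dots,n_d}(z_2,\dots,z_d),\mathrm{Li}_{n_1,\dots,n_d}(z_1,\dots,z_d)\big)^{\mathtt T}$, where $\mathrm{Li}$ denotes the Carlitz multiple polylogarithm series. (2) The map $z_d\mapsto\vec{\mathrm{Li}}_{n_1,\dots,n_d}(z_1,\dots,z_{d-1},z_d)$, $\mathbb{C}_\infty\to\mathbb{C}_\infty^d/M^{z_1,\dots,z_{d-1}}_{n_1,\dots,n_d}$, is locally rigid-analytic: for each $z\in\mathbb{C}_\infty$ there exist a closed disk $U\ni z$ in $\mathbb{C}_\infty$ and a closed polydisk $V\subset\mathbb{C}_\infty^d$ injecting into $\mathbb{C}_\infty^d/M^{z_1,\dots,z_{d-1}}_{n_1,\dots,n_d}$ and containing the image of $U$, such that the induced map $U\to V$ is given by rigid analytic functions.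
   Context: Notation: $q$ a prime power, $A=\mathbb{F}_q[\theta]$, $|\theta|_\infty=q$, $\mathbb{C}_\infty$ the completion of an algebraic closure of $\mathbb{F}_q((1/\theta))$. $\mathbb{T}\subset\mathbb{C}_\infty[[t]]$ the Tate algebra; twist $(\sum a_it^i)^{(1)}=\sum a_i^qt^i$; $\wp(f)=f-f^{(1)}$ is surjective $\mathbb{T}\to\mathbb{T}$, $\mathbb{F}_q[t]$-linear, kernel $\mathbb{F}_q[t]$. Fix a $(q-1)$-th root of $-\theta$, $\Omega=(-\theta)^{-q/(q-1)}\prod_{i\ge1}(1-t/\theta^{q^i})$ (entire, invertible in $\mathbb{T}$), $\tilde\pi=1/\Omega(\theta)$. $L_0=1$, $L_i=(\theta-\theta^q)\cdots(\theta-\theta^{q^i})$; $\mathrm{Li}_{m_1,\dots,m_r}(x_1,\dots,x_r)=\sum_{0\le i_1<\dots<i_r}x_1^{q^{i_1}}\cdots x_r^{q^{i_r}}/(L_{i_1}^{m_1}\cdots L_{i_r}^{m_r})$, converging on $\mathbb{D}=\{(x_i)\in\mathbb{C}_\infty^r:\prod_j(|x_j|_\infty q^{-qm_j/(q-1)})^{q^{i_j}}\to0$ as $0\le i_1<\dots<i_r\to\infty\}$; $\mathbb{D}$ in the claim is this region for $(n_1,\dots,n_d)$. Construction: depth-$r$ system for $Y_1,\dots,Y_r\in\mathbb{T}$: $(F_1,\dots,F_r)\in\mathbb{T}^r$ with $\wp(F_i)=Y_{r-i+1}F_{i-1}^{(1)}$, $F_0=1$ (solutions exist). Let $w=n_1+\dots+n_d$,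 view $z_i$ as constants in $\mathbb{T}$ and put $Y_i=\Omega^{n_i}z_i$. For $0\le k\le d-1$ choose a solution $(G_1,\dots,G_k)$ of the depth-$k$ system for $(Y_1,\dots,Y_k)$; the generator is $\Omega^{-w}(0,\dots,0,1,G_1,\dots,G_k)^{\mathtt T}$ ($d-k-1$ zeros). For $z_d\in\mathbb{C}_\infty$, $\vec{\mathfrak{Li}}_{n_1,\dots,n_d}(z_1,\dots,z_d)$ is the set of vectors $\Omega^{-w}(F_1,\dots,F_d)^{\mathtt T}$ with $(F_i)$ a solution of the depth-$d$ system for $(Y_1,\dots,Y_d)$; it is a coset of the $\mathbb{F}_q[t]$-module generated by the $d$ generators. All these entries, divided by appropriate powers of $\Omega$, have infinite radius of convergence, so they can be evaluated at $t=\theta$. The monodromy module $M^{z_1,\dots,z_{d-1}}_{n_1,\dots,n_d}\subset\mathbb{C}_\infty^d$ is the $A$-module generated by the values at $t=\theta$ of the $d$ generators (it does not depend on choices), and $\vec{\mathrm{Li}}_{n_1,\dots,n_d}(z_1,\dots,z_d)\in\mathbb{C}_\infty^d/M^{z_1,\dots,z_{d-1}}_{n_1,\dots,n_d}$ is the class of the value at $t=\theta$ of any element of $\vec{\mathfrak{Li}}_{n_1,\dots,n_d}(z_1,\dots,z_d)$.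
   Formalization: Part (1) also assumes each tail (z_{d-p+1},…,z_d), p<d, lies in its own region D, so every Li in the displayed vector converges; this is automatic if z_1,…,z_{d-1} are nonzero, but fails e.g. for d=2, z_1=0, z_2 large, where Li_{n_2}(z_2) diverges. *)

theory Defs
  imports "HOL-Analysis.Analysis" "HOL-Computational_Algebra.Formal_Laurent_Series"
begin

section \<open>The field C_infinity\<close>

class complete_nonarch_field = field + complete_space +
  fixes absval :: "'a \<Rightarrow> real"
  assumes dist_absval: "dist x y = absval (x - y)"
    and absval_mult: "absval (x * y) = absval x * absval y"
    and absval_ultrametric: "absval (x + y) \<le> max (absval x) (absval y)"

definition algebraic_over :: "('k::field \<Rightarrow> 'c::field) \<Rightarrow> 'c set" where
  "algebraic_over \<iota> = {x. \<exists>p. p \<noteq> 0 \<and> poly (map_poly \<iota> p) x = 0}"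

text \<open>
  \<open>\<iota>\<close> exhibits the valued field \<open>'c\<close> as the completion of an algebraic closure of
  F_q((1/theta)), where F_q is the finite field \<open>'f\<close>, 1/theta is the Laurent variable
  \<open>fls_X\<close>, and the absolute value is normalised by |theta| = q.
  Since absolute values extend uniquely to algebraic extensions of a complete field,
  this determines \<open>'c\<close> up to isometric isomorphism.
\<close>

definition is_C_infinity :: "('f::{field,finite} fls \<Rightarrow> 'c::complete_nonarch_field) \<Rightarrow> bool" where
  "is_C_infinity \<iota> \<longleftrightarrow>
     \<iota> 1 = 1 \<and> (\<forall>f g. \<iota> (f + g) = \<iota> f + \<iota> g) \<and> (\<forall>f g. \<iota> (f * g) = \<iota> f * \<iota> g) \<and>
     (\<forall>f. f \<noteq> 0 \<longrightarrow> absval (\<iota> f) = real CARD('f) powi (- fls_subdegree f)) \<and>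
     (\<forall>p. degree p > 0 \<and> (\<forall>i. coeff p i \<in> algebraic_over \<iota>) \<longrightarrow>
          (\<exists>x \<in> algebraic_over \<iota>. poly p x = 0)) \<and>
     closure (algebraic_over \<iota>) = UNIV"

text \<open>The subring A = F_q[theta].\<close>

definition ring_A :: "('f::{field,finite} fls \<Rightarrow> 'c::complete_nonarch_field) \<Rightarrow> 'c set" where
  "ring_A \<iota> = range (\<lambda>p :: 'f poly. poly (map_poly (\<lambda>a. \<iota> (fls_const a)) p) (\<iota> fls_X_inv))"

section \<open>Tate algebra, twist, and Omega\<close>

definition tate_algebra :: "'c::complete_nonarch_field fps set" where
  "tate_algebra = {f. fps_nth f \<longlonglongrightarrow> 0}"

definition twist :: "nat \<Rightarrow> 'c::complete_nonarch_field fps \<Rightarrow> 'c fps" where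
  "twist q f = Abs_fps (\<lambda>i. fps_nth f i ^ q)"

definition wp :: "nat \<Rightarrow> 'c::complete_nonarch_field fps \<Rightarrow> 'c fps" where
  "wp q f = f - twist q f"

definition fps_value :: "'c::complete_nonarch_field fps \<Rightarrow> 'c \<Rightarrow> 'c" where
  "fps_value f x = (\<Sum>i. fps_nth f i * x ^ i)"

text \<open>
  \<open>\<rho>\<close> is the chosen (q-1)-th root of -theta, so that (-theta)^(-q/(q-1)) is \<open>inverse (\<rho> ^ q)\<close>.
  The infinite product does not converge in the X-adic metric of \<^typ>\<open>'c fps\<close>, so its
  coefficients are taken as limits in \<open>'c\<close>.
\<close>

definition Omega :: "nat \<Rightarrow> 'c::complete_nonarch_field \<Rightarrow> 'c \<Rightarrow> 'c fps" where
  "Omega q \<theta> \<rho> = fps_const (inverse (\<rho> ^ q)) *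
     Abs_fps (\<lambda>k. lim (\<lambda>N. fps_nth (\<Prod>i=1..N. 1 - fps_const (1 / \<theta> ^ (q ^ i)) * fps_X) k))"

definition pi_tilde :: "nat \<Rightarrow> 'c::complete_nonarch_field \<Rightarrow> 'c \<Rightarrow> 'c" where
  "pi_tilde q \<theta> \<rho> = 1 / fps_value (Omega q \<theta> \<rho>) \<theta>"

section \<open>Carlitz multiple polylogarithm series\<close>

text \<open>Tuples of length r are functions of which only the values on \<open>{1..r}\<close> matter.\<close>

definition carlitz_L :: "nat \<Rightarrow> 'c::complete_nonarch_field \<Rightarrow> nat \<Rightarrow> 'c" where
  "carlitz_L q \<theta> i = (\<Prod>k=1..i. \<theta> - \<theta> ^ (q ^ k))"

definition increasing_tuples :: "nat \<Rightarrow> (nat \<Rightarrow> nat) set" where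
  "increasing_tuples r = {i \<in> {1..r} \<rightarrow>\<^sub>E UNIV. strict_mono_on {1..r} i}"

definition carlitz_Li ::
    "nat \<Rightarrow> 'c::complete_nonarch_field \<Rightarrow> nat \<Rightarrow> (nat \<Rightarrow> nat) \<Rightarrow> (nat \<Rightarrow> 'c) \<Rightarrow> 'c" where
  "carlitz_Li q \<theta> r m x =
     (\<Sum>\<^sub>\<infinity>i\<in>increasing_tuples r. \<Prod>j=1..r. x j ^ (q ^ i j) / carlitz_L q \<theta> (i j) ^ m j)"

text \<open>
  The limit is along all but finitely many increasing tuples, equivalently as the
  largest index \<open>i r\<close> tends to infinity.
\<close>

definition convergence_region ::
    "nat \<Rightarrow> nat \<Rightarrow> (nat \<Rightarrow> nat) \<Rightarrow> (nat \<Rightarrow> 'c::complete_nonarch_field) set" where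
  "convergence_region q r m =
     {x. ((\<lambda>i. \<Prod>j=1..r. (absval (x j) * real q powr (- (real q * real (m j) / (real q - 1)))) ^ (q ^ i j))
            \<longlongrightarrow> 0) (inf cofinite (principal (increasing_tuples r)))}"

section \<open>Difference systems and the monodromy module\<close>

definition solves_system ::
    "nat \<Rightarrow> nat \<Rightarrow> (nat \<Rightarrow> 'c::complete_nonarch_field fps) \<Rightarrow> (nat \<Rightarrow> 'c fps) \<Rightarrow> bool" where
  "solves_system q r Y F \<longleftrightarrow>
     F 0 = 1 \<and>
     (\<forall>i\<in>{1..r}. F i \<in> tate_algebra \<and> wp q (F i) = Y (r - i + 1) * twist q (F (i - 1)))"

definition system_coeffs ::
    "nat \<Rightarrow> 'c::complete_nonarch_field \<Rightarrow> 'c \<Rightarrow> (nat \<Rightarrow> nat) \<Rightarrow> (nat \<Rightarrow> 'c) \<Rightarrow> nat \<Rightarrow> 'c fps" where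
  "system_coeffs q \<theta> \<rho> n z i = Omega q \<theta> \<rho> ^ n i * fps_const (z i)"

text \<open>Vectors of length d are the functions in \<open>{1..d} \<rightarrow>\<^sub>E UNIV\<close>.\<close>

definition vector_value ::
    "nat \<Rightarrow> 'c::complete_nonarch_field \<Rightarrow> (nat \<Rightarrow> 'c fps) \<Rightarrow> nat \<Rightarrow> 'c" where
  "vector_value d \<theta> v = (\<lambda>p\<in>{1..d}. fps_value (v p) \<theta>)"

text \<open>
  The argument \<open>G\<close> is the chosen solution of the depth-k system;
  its entry \<open>G 0 = 1\<close> supplies the leading 1 in position d - k.
\<close>

definition generator ::
    "nat \<Rightarrow> 'c::complete_nonarch_field \<Rightarrow> 'c \<Rightarrow> nat \<Rightarrow> (nat \<Rightarrow> nat) \<Rightarrow> nat \<Rightarrow> (nat \<Rightarrow> 'c fps) \<Rightarrow> nat \<Rightarrow> 'c fps" where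
  "generator q \<theta> \<rho> d n k G =
     (\<lambda>p\<in>{1..d}. inverse (Omega q \<theta> \<rho>) ^ (\<Sum>i=1..d. n i) *
                   (if p < d - k then 0 else G (p - (d - k))))"

definition monodromy_module ::
    "('f::{field,finite} fls \<Rightarrow> 'c::complete_nonarch_field) \<Rightarrow> 'c \<Rightarrow> nat \<Rightarrow> (nat \<Rightarrow> nat) \<Rightarrow>
     (nat \<Rightarrow> nat \<Rightarrow> 'c fps) \<Rightarrow> (nat \<Rightarrow> 'c) set" where
  "monodromy_module \<iota> \<rho> d n G =
     (let q = CARD('f); \<theta> = \<iota> fls_X_inv in
      {\<lambda>p\<in>{1..d}. \<Sum>k<d. a k * vector_value d \<theta> (generator q \<theta> \<rho> d n k (G k)) p | a.
         \<forall>k<d. a k \<in> ring_A \<iota>})"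

definition coset :: "nat \<Rightarrow> (nat \<Rightarrow> 'c::complete_nonarch_field) set \<Rightarrow> (nat \<Rightarrow> 'c) \<Rightarrow> (nat \<Rightarrow> 'c) set" where
  "coset d M v = (\<lambda>m. \<lambda>p\<in>{1..d}. v p + m p) ` M"

definition Li_vectors ::
    "nat \<Rightarrow> 'c::complete_nonarch_field \<Rightarrow> 'c \<Rightarrow> nat \<Rightarrow> (nat \<Rightarrow> nat) \<Rightarrow> (nat \<Rightarrow> 'c) \<Rightarrow> (nat \<Rightarrow> 'c fps) set" where
  "Li_vectors q \<theta> \<rho> d n z =
     {\<lambda>p\<in>{1..d}. inverse (Omega q \<theta> \<rho>) ^ (\<Sum>i=1..d. n i) * F p | F.
        solves_system q d (system_coeffs q \<theta> \<rho> n z) F}"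

text \<open>
  The union of the classes modulo M of the values of all elements of \<open>Li_vectors\<close>.
  An equation \<open>Li_class q \<theta> \<rho> d n z M = coset d M v\<close> therefore says that
  \<open>Li_vectors\<close> is non-empty and that every element of it has a value in the class of \<open>v\<close>
  (M being a submodule).
\<close>

definition Li_class ::
    "nat \<Rightarrow> 'c::complete_nonarch_field \<Rightarrow> 'c \<Rightarrow> nat \<Rightarrow> (nat \<Rightarrow> nat) \<Rightarrow> (nat \<Rightarrow> 'c) \<Rightarrow> (nat \<Rightarrow> 'c) set \<Rightarrow> (nat \<Rightarrow> 'c) set" where
  "Li_class q \<theta> \<rho> d n z M = (\<Union>v\<in>Li_vectors q \<theta> \<rho> d n z. coset d M (vector_value d \<theta> v))"

section \<open>Rigid analytic functions on closed disks\<close>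

text \<open>Radii of disks and polydisks lie in the value group of \<open>'c\<close>.\<close>

definition closed_disk :: "'c::complete_nonarch_field set \<Rightarrow> bool" where
  "closed_disk U \<longleftrightarrow> (\<exists>c (a::'c). a \<noteq> 0 \<and> U = cball c (absval a))"

definition closed_polydisk :: "nat \<Rightarrow> (nat \<Rightarrow> 'c::complete_nonarch_field) set \<Rightarrow> bool" where
  "closed_polydisk d V \<longleftrightarrow>
     (\<exists>c (a :: nat \<Rightarrow> 'c). (\<forall>p\<in>{1..d}. a p \<noteq> 0) \<and> V = (\<Pi>\<^sub>E p\<in>{1..d}. cball (c p) (absval (a p))))"

definition rigid_analytic_on :: "'c::complete_nonarch_field set \<Rightarrow> ('c \<Rightarrow> 'c) \<Rightarrow> bool" where
  "rigid_analytic_on U f \<longleftrightarrow>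
     (\<exists>c a b. a \<noteq> 0 \<and> U = cball c (absval a) \<and> (\<lambda>k. b k * a ^ k) \<longlonglongrightarrow> 0 \<and>
              (\<forall>x\<in>U. (\<lambda>k. b k * (x - c) ^ k) sums f x))"

section \<open>Tails of points of the convergence region\<close>

text \<open>
  If no argument but possibly the last vanishes, then all tails of a point of the convergence
  region lie in their own convergence regions. This fails for vanishing arguments: (0, x) lies in
  the region of depth 2 for every x, although the depth-1 series at x diverges if x is
  large. Statements involving the series of all tails therefore assume their
  convergence. The proof compares the tuple i of
  length p with the tuple (0, ..., s - 1, i + s) of length s + p.
\<close>

lemma convergence_region_tail:
  fixes x :: "nat \<Rightarrow> 'c::complete_nonarch_field"
  assumes q: "q > 0" and x: "x \<in> convergence_region q (s + p) m"
    and nz: "\<And>j. j \<in> {1..s} \<Longrightarrow> x j \<noteq> 0"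
  shows "(\<lambda>j. x (s + j)) \<in> convergence_region q p (\<lambda>j. m (s + j))"
proof -
  define a where "a = (\<lambda>j. absval (x j) * real q powr (- (real q * real (m j) / (real q - 1))))"
  define h where "h = (\<lambda>(i::nat\<Rightarrow>nat). \<lambda>j\<in>{1..s+p}. if j \<le> s then j - 1 else i (j - s) + s)"
  have a0: "a j \<ge> 0" for j
  proof -
    have "absval (x j) = dist (x j) 0" by (simp add: dist_absval)
    then have "absval (x j) \<ge> 0" by simp
    then show ?thesis by (simp add: a_def)
  qed
  have apos: "a j > 0" if "j \<in> {1..s}" for j
  proof -
    have "absval (x j) = dist (x j) 0" by (simp add: dist_absval)
    then have "absval (x j) > 0" using nz[OF that] by simp
    then show ?thesis using q by (simp add: a_def)
  qed
  have h_in: "h i \<in> increasing_tuples (s + p)" if "i \<in> increasing_tuples p" for i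
  proof -
    have sm: "strict_mono_on {1..p} i" using that by (simp add: increasing_tuples_def)
    have "h i k < h i l" if kl: "k \<in> {1..s+p}" "l \<in> {1..s+p}" "k < l" for k l
    proof (cases "s < k")
      case True
      then have "i (k - s) < i (l - s)"
        using kl by (intro strict_mono_onD[OF sm]) auto
      then show ?thesis using True kl by (simp add: h_def)
    next
      case False
      then show ?thesis using kl by (auto simp: h_def)
    qed
    then show ?thesis
      by (auto simp: increasing_tuples_def strict_mono_on_def h_def)
  qed
  have h_inj: "inj_on h (increasing_tuples p)"
  proof (rule inj_onI)
    fix i i' assume i: "i \<in> increasing_tuples p" and i': "i' \<in> increasing_tuples p" and e: "h i = h i'"
    show "i = i'"
    proof (rule extensionalityI[of _ "{1..p}"])
      show "i \<in> extensional {1..p}" "i' \<in> extensional {1..p}"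
        using i i' by (auto simp: increasing_tuples_def PiE_def)
      fix j assume "j \<in> {1..p}"
      then show "i j = i' j" using fun_cong[OF e, of "s + j"] by (auto simp: h_def)
    qed
  qed
  let ?f = "\<lambda>i. \<Prod>j=1..s+p. a j ^ (q ^ i j)"
  let ?g = "\<lambda>i. \<Prod>j=1..p. a (s + j) ^ (q ^ i j)"
  define C where "C = (\<Prod>j=1..s. a j ^ (q ^ (j - 1)))"
  have C: "C > 0" unfolding C_def using apos by (intro prod_pos) auto
  have fh: "?f (h i) = C * ?g i ^ (q ^ s)" for i
  proof -
    have "?f (h i) = (\<Prod>j=1..s. a j ^ (q ^ h i j)) * (\<Prod>j=s+1..s+p. a j ^ (q ^ h i j))"
      by (rule prod.ub_add_nat) simp
    also have "(\<Prod>j=1..s. a j ^ (q ^ h i j)) = C"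
      unfolding C_def by (intro prod.cong) (auto simp: h_def)
    also have "(\<Prod>j=s+1..s+p. a j ^ (q ^ h i j)) = (\<Prod>j=1..p. a (s + j) ^ (q ^ h i (s + j)))"
      using prod.shift_bounds_cl_nat_ivl[of "\<lambda>j. a j ^ (q ^ h i j)" 1 s p] by (simp add: add.commute)
    also have "\<dots> = (\<Prod>j=1..p. (a (s + j) ^ (q ^ i j)) ^ (q ^ s))"
      by (intro prod.cong) (auto simp: h_def power_add power_mult)
    finally show ?thesis by (simp add: prod_power_distrib)
  qed
  have lim: "(?f \<longlongrightarrow> 0) (inf cofinite (principal (increasing_tuples (s + p))))"
    using x by (simp add: convergence_region_def a_def)
  have "(?g \<longlongrightarrow> 0) (inf cofinite (principal (increasing_tuples p)))"
  proof (rule tendstoI)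
    fix e :: real assume e: "e > 0"
    define e' where "e' = C * e ^ (q ^ s)"
    have "e' > 0" using C e by (simp add: e'_def)
    from tendstoD[OF lim this]
    have fin: "finite {i \<in> increasing_tuples (s + p). \<not> dist (?f i) 0 < e'}"
      by (simp add: eventually_inf_principal eventually_cofinite conj_commute)
    let ?B = "{i \<in> increasing_tuples p. \<not> dist (?g i) 0 < e}"
    have "h ` ?B \<subseteq> {i \<in> increasing_tuples (s + p). \<not> dist (?f i) 0 < e'}"
    proof safe
      fix i assume i: "i \<in> increasing_tuples p" and n: "\<not> dist (?g i) 0 < e"
      show "h i \<in> increasing_tuples (s + p)" by (rule h_in[OF i])
      assume lt: "dist (?f (h i)) 0 < e'"
      have g0: "?g i \<ge> 0" using a0 by (intro prod_nonneg) auto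
      then have "e \<le> ?g i" using n by (simp add: dist_norm)
      then have "e ^ (q ^ s) \<le> ?g i ^ (q ^ s)" using e by (intro power_mono) auto
      then have "e' \<le> ?f (h i)" unfolding fh e'_def using C by simp
      then show False using lt by (simp add: dist_norm)
    qed
    then have "finite (h ` ?B)" using fin finite_subset by blast
    moreover have "inj_on h ?B" using h_inj by (rule inj_on_subset) auto
    ultimately have "finite ?B" by (rule finite_imageD)
    then show "\<forall>\<^sub>F i in inf cofinite (principal (increasing_tuples p)). dist (?g i) 0 < e"
      by (simp add: eventually_inf_principal eventually_cofinite conj_commute)
  qed
  then show ?thesis by (simp add: convergence_region_def a_def)
qed

end

theory Submission
  imports Defs
begin

text \<open>
  All solutions of the difference systems converge at \<open>\<theta>\<close>, because an element of the Tate algebra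
  and its image under wp have coefficients of the same size from some index on. Two solutions
  of the same system differ by a combination of the generators over the kernel F_q[t]
  of wp, so the class of the values modulo M can be computed from any solution. In the
  region of convergence a solution is
  \<open>F\<^sub>p = \<Sum> \<Prod>\<^sub>j Y\<^bsub>d-p+j\<^esub>\<^bsup>(i\<^sub>j)\<^esup>\<close>, summed over
  \<open>0 \<le> i\<^sub>1 < \<dots> < i\<^sub>p\<close>, and the functional equation of Omega gives \<open>\<Omega>\<^bsup>(i)\<^esup>(\<theta>) = \<Omega>(\<theta>) / L\<^sub>i\<close>,
  which turns its value at \<open>\<theta>\<close> into the polylogarithm series.
  For the local analyticity, the system is affine in \<open>z\<^sub>d\<close>: a solution for
  \<open>z\<^sub>0 + u\<close> is a solution for \<open>z\<^sub>0\<close> plus the series solution for \<open>u\<close>, which converges for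
  all small \<open>u\<close> whatever the other arguments are and is a power series in \<open>u\<close>. Finally M is discrete since its
  generators are triangular with diagonal entries \<open>\<pi>\<^sup>w\<close> and nonzero elements of A have absolute value at
  least 1.
\<close>

section \<open>Non-archimedean absolute values and summation\<close>

text \<open>Two comparisons of sizes carry the argument. If \<open>0 < |x| < 1\<close> then
  \<open>|x^q| < |x|\<close>, so \<open>x - x^q\<close> has the size of \<open>x\<close>; as wp acts
  on each coefficient separately, this controls solutions for which no formula is known. And for
  \<open>i_1 < ... < i_p\<close> the exponents \<open>q^(i_1), ..., q^(i_(p-1))\<close> add up to at
  most \<open>q^(i_p)\<close>, so a small enough last argument outweighs all the others, however
  large they are. Hence a solution at \<open>z0 + u\<close> is an arbitrary, inexplicit solution at
  \<open>z0\<close> plus a convergent series in \<open>u\<close>, even if \<open>z0\<close> lies far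
  outside the region of convergence. The size 1/q to which the series is forced is tuned to M: it
  moves each coordinate by at most \<open>|\<pi>^w| / q\<close>, while a nonzero element of M has a
  coordinate of size at least \<open>|\<pi>^w|\<close>, so a polydisk of radius
  \<open>|\<pi>^w / \<theta>|\<close> fits in between. Series are treated as unconditional sums over
  sets of tuples, because the difference equation comes from splitting the index set and the value
  at \<open>\<theta>\<close> from exchanging two summations.\<close>

lemma absval_zero [simp]: "absval (0::'c::complete_nonarch_field) = 0"
  using dist_absval[of "0::'c" 0] by simp

lemma absval_nonneg [simp]: "absval (x::'c::complete_nonarch_field) \<ge> 0"
  using dist_absval[of x 0] by (metis diff_zero zero_le_dist)

lemma absval_eq_0_iff [simp]: "absval (x::'c::complete_nonarch_field) = 0 \<longleftrightarrow> x = 0"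
  using dist_absval[of x 0] by (metis diff_zero dist_eq_0_iff)

lemma absval_pos_iff [simp]: "absval (x::'c::complete_nonarch_field) > 0 \<longleftrightarrow> x \<noteq> 0"
  by (metis absval_eq_0_iff absval_nonneg less_le)

lemma absval_one [simp]: "absval (1::'c::complete_nonarch_field) = 1"
  using absval_mult[of "1::'c" 1] by (metis absval_eq_0_iff mult_1 mult_cancel_right1 zero_neq_one)

lemma absval_minus [simp]: "absval (- x) = absval (x::'c::complete_nonarch_field)"
  using dist_absval[of x 0] dist_absval[of 0 x] by (simp add: dist_commute)

lemma absval_minus_commute: "absval (x - y) = absval (y - x :: 'c::complete_nonarch_field)"
  by (metis absval_minus minus_diff_eq)

lemma absval_power: "absval (x ^ n) = absval (x::'c::complete_nonarch_field) ^ n"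
  by (induction n) (auto simp: absval_mult)

lemma absval_inverse: "absval (inverse x) = inverse (absval (x::'c::complete_nonarch_field))"
proof (cases "x = 0")
  case False
  then have "absval x * absval (inverse x) = 1"
    by (metis absval_mult absval_one right_inverse)
  then show ?thesis by (simp add: inverse_unique)
qed simp

lemma absval_divide: "absval (x / y) = absval x / absval (y::'c::complete_nonarch_field)"
  by (simp add: divide_inverse absval_mult absval_inverse)

lemma absval_add_le:
  "absval x \<le> B \<Longrightarrow> absval y \<le> B \<Longrightarrow> absval (x + y :: 'c::complete_nonarch_field) \<le> B"
  using absval_ultrametric[of x y] by simp

lemma absval_diff_le:
  "absval x \<le> B \<Longrightarrow> absval y \<le> B \<Longrightarrow> absval (x - y :: 'c::complete_nonarch_field) \<le> B"
  using absval_add_le[of x B "- y"] by simp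

lemma absval_add_less:
  "absval x < B \<Longrightarrow> absval y < B \<Longrightarrow> absval (x + y :: 'c::complete_nonarch_field) < B"
  using absval_ultrametric[of x y] by simp

lemma absval_sum_le:
  fixes f :: "'i \<Rightarrow> 'c::complete_nonarch_field"
  assumes "\<And>i. i \<in> A \<Longrightarrow> absval (f i) \<le> B" and "B \<ge> 0"
  shows "absval (\<Sum>i\<in>A. f i) \<le> B"
  using assms(1)
  by (induction A rule: infinite_finite_induct) (auto intro!: absval_add_le simp: assms(2))

lemma absval_sum_less:
  fixes f :: "'i \<Rightarrow> 'c::complete_nonarch_field"
  assumes "\<And>i. i \<in> A \<Longrightarrow> absval (f i) < B" and "B > 0"
  shows "absval (\<Sum>i\<in>A. f i) < B"
  using assms(1)
  by (induction A rule: infinite_finite_induct) (auto intro!: absval_add_less simp: assms(2))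

lemma absval_eq_of_dominant:
  fixes x y :: "'c::complete_nonarch_field"
  assumes "absval y < absval x"
  shows "absval (x + y) = absval x"
proof (rule antisym)
  show "absval (x + y) \<le> absval x" using assms by (intro absval_add_le) auto
  have "absval x \<le> max (absval (x + y)) (absval y)"
    using absval_ultrametric[of "x + y" "- y"] by simp
  then show "absval x \<le> absval (x + y)" using assms by auto
qed

lemma tendsto_absval_iff:
  fixes f :: "'i \<Rightarrow> 'c::complete_nonarch_field"
  shows "(f \<longlongrightarrow> l) F \<longleftrightarrow> ((\<lambda>i. absval (f i - l)) \<longlongrightarrow> 0) F"
  unfolding tendsto_dist_iff[of f] dist_absval ..

text \<open>Makes the \<open>has_sum\<close> rules for topological groups and monoids, and the limit
  rules for sums, available for \<open>'c\<close>.\<close>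

instance complete_nonarch_field \<subseteq> topological_ab_group_add
proof
  fix a b :: 'a
  show "((\<lambda>x. fst x + snd x) \<longlongrightarrow> a + b) (nhds a \<times>\<^sub>F nhds b)"
  proof (rule tendstoI)
    fix e :: real assume "e > 0"
    have "eventually (\<lambda>x. dist x a < e) (nhds a)" "eventually (\<lambda>x. dist x b < e) (nhds b)"
      using \<open>e > 0\<close> by (auto simp: eventually_nhds_metric)
    then show "eventually (\<lambda>x. dist (fst x + snd x) (a + b) < e) (nhds a \<times>\<^sub>F nhds b)"
      unfolding eventually_prod_filter
    proof (intro exI conjI allI impI)
      fix x y assume "dist x a < e" "dist y b < e"
      then have "absval ((x - a) + (y - b)) < e"
        by (intro absval_add_less) (auto simp: dist_absval)
      then show "dist (fst (x, y) + snd (x, y)) (a + b) < e"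
        by (simp add: dist_absval algebra_simps)
    qed
  qed
  show "(uminus \<longlongrightarrow> - a) (nhds a)"
  proof (rule tendstoI)
    fix e :: real assume "e > 0"
    then have "eventually (\<lambda>x. dist x a < e) (nhds a)" by (auto simp: eventually_nhds_metric)
    then show "eventually (\<lambda>x. dist (- x) (- a) < e) (nhds a)"
      by eventually_elim (simp add: dist_absval absval_minus_commute)
  qed
qed

instance complete_nonarch_field \<subseteq> topological_monoid_mult
proof
  fix a b :: 'a
  have 1: "((\<lambda>x. fst x) \<longlongrightarrow> a) (nhds a \<times>\<^sub>F nhds b)" "((\<lambda>x. snd x) \<longlongrightarrow> b) (nhds a \<times>\<^sub>F nhds b)"
    by (simp_all add: filterlim_fst filterlim_snd)
  let ?u = "\<lambda>x::'a\<times>'a. absval (fst x - a)" and ?v = "\<lambda>x::'a\<times>'a. absval (snd x - b)"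
  have "((\<lambda>x. ?u x * ?v x + ?u x * absval b + absval a * ?v x) \<longlongrightarrow> 0 * 0 + 0 * absval b + absval a * 0)
     (nhds a \<times>\<^sub>F nhds b)"
    using 1 unfolding tendsto_absval_iff by (intro tendsto_intros) auto
  then have *: "((\<lambda>x. ?u x * ?v x + ?u x * absval b + absval a * ?v x) \<longlongrightarrow> 0) (nhds a \<times>\<^sub>F nhds b)"
    by simp
  have "absval (x * y - a * b) \<le>
     absval (x - a) * absval (y - b) + absval (x - a) * absval b + absval a * absval (y - b)" (is "_ \<le> ?r") for x y :: 'a
  proof -
    have "x * y - a * b = (x - a) * (y - b) + (x - a) * b + a * (y - b)"
      by (simp add: algebra_simps)
    also have "absval \<dots> \<le> ?r"
      by (intro absval_add_le) (auto simp: absval_mult)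
    finally show ?thesis .
  qed
  then show "((\<lambda>x. fst x * snd x) \<longlongrightarrow> a * b) (nhds a \<times>\<^sub>F nhds b)"
    unfolding tendsto_absval_iff
    by (intro tendsto_sandwich[OF _ _ tendsto_const *] always_eventually allI) auto
qed

lemma tendsto_power_const:
  fixes f :: "'i \<Rightarrow> 'c::complete_nonarch_field"
  shows "(f \<longlongrightarrow> a) F \<Longrightarrow> ((\<lambda>x. f x ^ n) \<longlongrightarrow> a ^ n) F"
  by (rule tendsto_power_strong[OF _ tendsto_const])

lemma closed_absval_le: "closed {x::'c::complete_nonarch_field. absval x \<le> B}"
proof -
  have "{x::'c. absval x \<le> B} = cball 0 B"
    by (auto simp: dist_absval)
  then show ?thesis by simp
qed

section \<open>Unconditional summation of null families\<close>

definition null_family :: "('i \<Rightarrow> 'c::complete_nonarch_field) \<Rightarrow> 'i set \<Rightarrow> bool" where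
  "null_family f A \<longleftrightarrow> (\<forall>e>0. finite {i\<in>A. absval (f i) \<ge> e})"

text \<open>The non-archimedean substitute for absolute summability. \<open>E n\<close> collects the
  terms of size at least \<open>1/(n+1)\<close>. By the ultrametric inequality the sum over any
  finite set containing \<open>E n\<close> differs from the sum over \<open>E n\<close> by at most
  \<open>1/(n+1)\<close>, which gives both the limit and the convergence along all finite
  subsets.\<close>

lemma null_family_summable:
  fixes f :: "'i \<Rightarrow> 'c::complete_nonarch_field"
  assumes "null_family f A"
  shows "f summable_on A"
proof -
  define E where "E n = {i\<in>A. absval (f i) \<ge> inverse (real (Suc n))}" for n
  have fE: "finite (E n)" for n
    using assms by (auto simp: E_def null_family_def)
  have dec: "E m \<subseteq> E n" if "m \<le> n" for m n
  proof -
    have "inverse (real (Suc n)) \<le> inverse (real (Suc m))" using that by (simp add: field_simps)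
    then show ?thesis unfolding E_def using order_trans by blast
  qed
  have E_subset: "E n \<subseteq> A" for n by (auto simp: E_def)
  have diff: "absval (sum f X - sum f (E n)) \<le> inverse (real (Suc n))"
    if "finite X" "E n \<subseteq> X" "X \<subseteq> A" for X n
  proof -
    have "sum f X - sum f (E n) = sum f (X - E n)"
      using that fE by (simp add: sum_diff)
    also have "absval \<dots> \<le> inverse (real (Suc n))"
      using that by (intro absval_sum_le) (auto simp: E_def not_le less_imp_le)
    finally show ?thesis .
  qed
  have "Cauchy (\<lambda>n. sum f (E n))"
  proof (rule metric_CauchyI)
    fix e :: real assume "e > 0"
    then obtain N where N: "inverse (real (Suc N)) < e" using reals_Archimedean by blast
    have a: "absval (sum f (E m) - sum f (E N)) \<le> inverse (real (Suc N))" if "m \<ge> N" for m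
      using that fE dec E_subset by (intro diff)
    show "\<exists>M. \<forall>m\<ge>M. \<forall>n\<ge>M. dist (sum f (E m)) (sum f (E n)) < e"
    proof (intro exI[of _ N] allI impI)
      fix m n assume "m \<ge> N" "n \<ge> N"
      then have "absval ((sum f (E m) - sum f (E N)) - (sum f (E n) - sum f (E N))) \<le> inverse (real (Suc N))"
        by (intro absval_diff_le a)
      then show "dist (sum f (E m)) (sum f (E n)) < e" using N by (simp add: dist_absval)
    qed
  qed
  then obtain l where l: "(\<lambda>n. sum f (E n)) \<longlonglongrightarrow> l"
    using Cauchy_convergent convergent_def by blast
  have "(f has_sum l) A"
    unfolding has_sum_def
  proof (rule tendstoI)
    fix e :: real assume e: "e > 0"
    from reals_Archimedean[OF e] obtain N where N: "inverse (real (Suc N)) < e" by blast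
    have "\<forall>\<^sub>F n in sequentially. dist (sum f (E n)) l < e \<and> n \<ge> N"
      using tendstoD[OF l e] eventually_ge_at_top[of N] by eventually_elim auto
    then obtain n where n: "dist (sum f (E n)) l < e" "n \<ge> N"
      by (auto simp: eventually_sequentially)
    have ne: "inverse (real (Suc n)) < e"
      using N n(2) by (smt (verit) inverse_le_iff_le of_nat_0_less_iff of_nat_mono zero_less_Suc Suc_le_mono)
    show "\<forall>\<^sub>F X in finite_subsets_at_top A. dist (sum f X) l < e"
      unfolding eventually_finite_subsets_at_top
    proof (intro exI[of _ "E n"] conjI allI impI)
      show "finite (E n)" by (rule fE)
      show "E n \<subseteq> A" by (auto simp: E_def)
      fix X assume X: "finite X \<and> E n \<subseteq> X \<and> X \<subseteq> A"
      have "absval ((sum f X - sum f (E n)) + (sum f (E n) - l)) < e"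
        using diff[of X n] X ne n(1) by (intro absval_add_less) (auto simp: dist_absval)
      then show "dist (sum f X) l < e" by (simp add: dist_absval)
    qed
  qed
  then show ?thesis by (auto simp: summable_on_def)
qed

lemma has_sum_absval_le:
  fixes f :: "'i \<Rightarrow> 'c::complete_nonarch_field"
  assumes "(f has_sum l) A" "\<And>i. i \<in> A \<Longrightarrow> absval (f i) \<le> B" "B \<ge> 0"
  shows "absval l \<le> B"
proof -
  have "l \<in> {x. absval x \<le> B}"
  proof (rule Lim_in_closed_set[OF closed_absval_le])
    show "(sum f \<longlongrightarrow> l) (finite_subsets_at_top A)" using assms(1) by (simp add: has_sum_def)
    show "\<forall>\<^sub>F X in finite_subsets_at_top A. sum f X \<in> {x. absval x \<le> B}"
      unfolding eventually_finite_subsets_at_top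
      by (intro exI[of _ "{}"]) (auto intro!: absval_sum_le assms)
  qed simp
  then show ?thesis by simp
qed

lemma has_sum_mult_left:
  fixes f :: "'i \<Rightarrow> 'c::complete_nonarch_field"
  assumes "(f has_sum l) A"
  shows "((\<lambda>i. c * f i) has_sum (c * l)) A"
proof -
  have "((\<lambda>X. c * sum f X) \<longlongrightarrow> c * l) (finite_subsets_at_top A)"
    using assms unfolding has_sum_def by (intro tendsto_intros)
  then show ?thesis by (simp add: has_sum_def sum_distrib_left)
qed

lemma null_family_nat: "null_family f (UNIV::nat set) \<longleftrightarrow> f \<longlonglongrightarrow> 0"
proof -
  have "finite {i. absval (f i) \<ge> e} \<longleftrightarrow> (\<forall>\<^sub>F n in sequentially. absval (f n) < e)" for e
    by (simp add: eventually_cofinite not_less flip: cofinite_eq_sequentially)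
  then show ?thesis
    by (auto simp: null_family_def tendsto_iff dist_absval)
qed

lemma sums_imp_null:
  fixes f :: "nat \<Rightarrow> 'c::complete_nonarch_field"
  assumes "f sums l"
  shows "f \<longlonglongrightarrow> 0"
proof -
  have "(\<lambda>n. sum f {..<Suc n} - sum f {..<n}) \<longlonglongrightarrow> l - l"
    using assms unfolding sums_def by (intro tendsto_intros LIMSEQ_Suc)
  then show ?thesis by simp
qed

lemma null_seq_has_sum:
  fixes f :: "nat \<Rightarrow> 'c::complete_nonarch_field"
  assumes "f \<longlonglongrightarrow> 0"
  shows "(f has_sum suminf f) UNIV"
proof -
  have "f summable_on UNIV" using assms null_family_nat null_family_summable by blast
  then obtain l where l: "(f has_sum l) UNIV" by (auto simp: summable_on_def)
  then show ?thesis using has_sum_imp_sums sums_unique by blast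
qed

text \<open>The differences form a series with null terms, and such a series converges here, so no
  rate of decay is required.\<close>

lemma telescope_convergent:
  fixes a :: "nat \<Rightarrow> 'c::complete_nonarch_field"
  assumes "(\<lambda>n. a (Suc n) - a n) \<longlonglongrightarrow> 0"
  shows "convergent a"
proof -
  have "(\<lambda>n. a (Suc n) - a n) sums (\<Sum>n. a (Suc n) - a n)"
    using null_seq_has_sum[OF assms] by (rule has_sum_imp_sums)
  then have "(\<lambda>n. a n - a 0) \<longlonglongrightarrow> (\<Sum>n. a (Suc n) - a n)"
    by (simp add: sums_def sum_lessThan_telescope)
  then have "(\<lambda>n. (a n - a 0) + a 0) \<longlonglongrightarrow> (\<Sum>n. a (Suc n) - a n) + a 0"
    by (intro tendsto_intros)
  then show ?thesis by (auto simp: convergent_def)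
qed

lemma null_family_bounded:
  assumes "null_family f A"
  obtains K where "K > 0" "\<And>i. i \<in> A \<Longrightarrow> absval (f i) \<le> K"
proof
  let ?E = "{i\<in>A. absval (f i) \<ge> 1}"
  let ?K = "1 + (\<Sum>i\<in>?E. absval (f i))"
  have E: "finite ?E" using assms by (auto simp: null_family_def)
  have "(\<Sum>i\<in>?E. absval (f i)) \<ge> 0" by (intro sum_nonneg) auto
  then show "?K > 0" by linarith
  show "absval (f i) \<le> ?K" if "i \<in> A" for i
  proof (cases "i \<in> ?E")
    case True
    then have "absval (f i) \<le> (\<Sum>i\<in>?E. absval (f i))"
      using E by (intro member_le_sum) auto
    then show ?thesis by simp
  next
    case False
    then show ?thesis using that \<open>(\<Sum>i\<in>?E. absval (f i)) \<ge> 0\<close> by auto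
  qed
qed

text \<open>With bounds K and L for the two families, a product of size at least e forces its
  factors to have size at least e/L and e/K, which leaves finitely many pairs. This is what
  justifies Cauchy products.\<close>

lemma null_family_times:
  assumes "null_family f A" "null_family g B"
  shows "null_family (\<lambda>(i, j). f i * g j) (A \<times> B)"
proof -
  obtain K where K: "K > 0" "\<And>i. i \<in> A \<Longrightarrow> absval (f i) \<le> K"
    using null_family_bounded[OF assms(1)] by blast
  obtain L where L: "L > 0" "\<And>i. i \<in> B \<Longrightarrow> absval (g i) \<le> L"
    using null_family_bounded[OF assms(2)] by blast
  show ?thesis unfolding null_family_def
  proof (intro allI impI)
    fix e :: real assume e: "e > 0"
    let ?S = "{i\<in>A. absval (f i) \<ge> e / L} \<times> {j\<in>B. absval (g j) \<ge> e / K}"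
    have "finite ?S"
      using assms e K L by (auto simp: null_family_def)
    moreover have "{ij\<in>A \<times> B. absval (case ij of (i, j) \<Rightarrow> f i * g j) \<ge> e} \<subseteq> ?S"
    proof
      fix p assume "p \<in> {ij\<in>A \<times> B. absval (case ij of (i, j) \<Rightarrow> f i * g j) \<ge> e}"
      then obtain i j where p: "p = (i, j)" and ij: "i \<in> A" "j \<in> B" and le: "e \<le> absval (f i * g j)"
        by auto
      have "e \<le> absval (f i) * L"
        using le L(2)[OF ij(2)] mult_left_mono[of "absval (g j)" L "absval (f i)"]
        by (simp add: absval_mult)
      moreover have "e \<le> K * absval (g j)"
        using le K(2)[OF ij(1)] mult_right_mono[of "absval (f i)" K "absval (g j)"]
        by (simp add: absval_mult)
      ultimately show "p \<in> ?S" using p ij K(1) L(1) by (auto simp: field_simps)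
    qed
    ultimately show "finite {ij\<in>A \<times> B. absval (case ij of (i, j) \<Rightarrow> f i * g j) \<ge> e}"
      by (rule rev_finite_subset)
  qed
qed

section \<open>Evaluation of power series\<close>

text \<open>Null terms are equivalent to convergence over a non-archimedean field. The Tate algebra
  is the case \<open>x = 1\<close>, so one set of closure properties serves both for membership in
  it and for evaluation at \<open>\<theta>\<close>.\<close>

definition convergent_at :: "'c::complete_nonarch_field \<Rightarrow> 'c fps set" where
  "convergent_at x = {f. (\<lambda>k. fps_nth f k * x ^ k) \<longlonglongrightarrow> 0}"

lemma fps_value_has_sum:
  assumes "f \<in> convergent_at x"
  shows "((\<lambda>k. fps_nth f k * x ^ k) has_sum fps_value f x) UNIV"
  using null_seq_has_sum assms unfolding convergent_at_def fps_value_def by blast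

lemma has_sum_imp_fps_value:
  assumes "((\<lambda>k. fps_nth f k * x ^ k) has_sum s) UNIV"
  shows "f \<in> convergent_at x" "fps_value f x = s"
  using has_sum_imp_sums[OF assms] sums_imp_null sums_unique
  by (auto simp: convergent_at_def fps_value_def)

lemma convergent_at_add:
  assumes "f \<in> convergent_at x" "g \<in> convergent_at x"
  shows "f + g \<in> convergent_at x" "fps_value (f + g) x = fps_value f x + fps_value g x"
proof -
  have "((\<lambda>k. fps_nth (f + g) k * x ^ k) has_sum fps_value f x + fps_value g x) UNIV"
    using has_sum_add[OF assms[THEN fps_value_has_sum]] by (simp add: algebra_simps)
  from has_sum_imp_fps_value[OF this]
  show "f + g \<in> convergent_at x" "fps_value (f + g) x = fps_value f x + fps_value g x" .
qed

lemma convergent_at_polynomial: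
  assumes "\<And>k. k > N \<Longrightarrow> fps_nth f k = 0"
  shows "f \<in> convergent_at x" "fps_value f x = (\<Sum>k\<le>N. fps_nth f k * x ^ k)"
proof -
  have "((\<lambda>k. fps_nth f k * x ^ k) has_sum (\<Sum>k\<le>N. fps_nth f k * x ^ k)) UNIV"
    by (rule has_sum_finite_neutralI[where B = "{..N}"]) (auto simp: assms)
  from has_sum_imp_fps_value[OF this]
  show "f \<in> convergent_at x" "fps_value f x = (\<Sum>k\<le>N. fps_nth f k * x ^ k)" .
qed

lemma convergent_at_const [simp]:
  "fps_const c \<in> convergent_at x" "fps_value (fps_const c) x = c"
  using convergent_at_polynomial[of 0 "fps_const c" x] by auto

lemma convergent_at_0 [simp]: "0 \<in> convergent_at x" "fps_value 0 x = 0"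
  using convergent_at_const[of 0 x] by simp_all

lemma convergent_at_1 [simp]: "1 \<in> convergent_at x" "fps_value 1 x = 1"
  using convergent_at_const[of 1 x] by simp_all

lemma convergent_at_X [simp]: "fps_X \<in> convergent_at x" "fps_value fps_X x = x"
  using convergent_at_polynomial[of 1 fps_X x] by auto

text \<open>The double family of products is null, hence summable over all pairs; summing it by rows
  gives the product of the values, and summing it along the antidiagonals gives the Cauchy
  product.\<close>

lemma convergent_at_mult:
  assumes "f \<in> convergent_at x" "g \<in> convergent_at x"
  shows "f * g \<in> convergent_at x" "fps_value (f * g) x = fps_value f x * fps_value g x"
proof -
  define a b where "a = (\<lambda>k. fps_nth f k * x ^ k)" and "b = (\<lambda>k. fps_nth g k * x ^ k)"
  have ab: "null_family a UNIV" "null_family b UNIV"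
    using assms by (auto simp: null_family_nat convergent_at_def a_def b_def)
  obtain l where l: "((\<lambda>(i, j). a i * b j) has_sum l) (UNIV \<times> UNIV)"
    using null_family_summable[OF null_family_times[OF ab]] by (auto simp: summable_on_def)
  have A: "(a has_sum fps_value f x) UNIV" and B: "(b has_sum fps_value g x) UNIV"
    using assms[THEN fps_value_has_sum] by (simp_all add: a_def b_def)
  have "((\<lambda>i. a i * fps_value g x) has_sum l) UNIV"
    using has_sum_SigmaD[OF l, of "\<lambda>i. a i * fps_value g x"] has_sum_mult_left[OF B] by simp
  moreover have "((\<lambda>i. a i * fps_value g x) has_sum (fps_value f x * fps_value g x)) UNIV"
    using has_sum_mult_left[OF A, of "fps_value g x"] by (simp add: mult.commute)
  ultimately have l_eq: "l = fps_value f x * fps_value g x"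
    using has_sum_unique by blast
  have "((\<lambda>(n, i). a i * b (n - i)) has_sum l) (Sigma UNIV (\<lambda>n. {0..n}))"
    using l by (subst has_sum_reindex_bij_witness[where T = "UNIV \<times> UNIV" and s' = l
          and i = "\<lambda>(i, j). (i + j, i)" and j = "\<lambda>(n, i). (i, n - i)"
          and h = "\<lambda>(i, j). a i * b j"]) auto
  then have "((\<lambda>n. \<Sum>i=0..n. a i * b (n - i)) has_sum l) UNIV"
    by (rule has_sum_SigmaD) auto
  moreover have "(\<Sum>i=0..n. a i * b (n - i)) = fps_nth (f * g) n * x ^ n" for n
  proof -
    have "x ^ n = x ^ i * x ^ (n - i)" if "i \<le> n" for i
      using that by (simp flip: power_add)
    then show ?thesis
      unfolding a_def b_def fps_mult_nth sum_distrib_right by (intro sum.cong) auto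
  qed
  ultimately have "((\<lambda>n. fps_nth (f * g) n * x ^ n) has_sum l) UNIV" by simp
  from has_sum_imp_fps_value[OF this]
  show "f * g \<in> convergent_at x" "fps_value (f * g) x = fps_value f x * fps_value g x"
    by (simp_all add: l_eq)
qed

lemma convergent_at_power:
  assumes "f \<in> convergent_at x"
  shows "f ^ n \<in> convergent_at x" "fps_value (f ^ n) x = fps_value f x ^ n"
  by (induction n) (auto simp: convergent_at_mult assms)

lemma convergent_at_prod:
  assumes "\<And>i. i \<in> A \<Longrightarrow> f i \<in> convergent_at x"
  shows "(\<Prod>i\<in>A. f i) \<in> convergent_at x \<and> fps_value (\<Prod>i\<in>A. f i) x = (\<Prod>i\<in>A. fps_value (f i) x)"
  using assms
  by (induction A rule: infinite_finite_induct) (auto simp: convergent_at_mult)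

lemma convergent_at_sum:
  assumes "\<And>i. i \<in> A \<Longrightarrow> f i \<in> convergent_at x"
  shows "(\<Sum>i\<in>A. f i) \<in> convergent_at x \<and> fps_value (\<Sum>i\<in>A. f i) x = (\<Sum>i\<in>A. fps_value (f i) x)"
  using assms
  by (induction A rule: infinite_finite_induct) (auto simp: convergent_at_add)

lemma convergent_at_diff:
  assumes "f \<in> convergent_at x" "g \<in> convergent_at x"
  shows "f - g \<in> convergent_at x" "fps_value (f - g) x = fps_value f x - fps_value g x"
proof -
  have "fps_const (- 1) * g \<in> convergent_at x"
    "fps_value (fps_const (- 1) * g) x = - fps_value g x"
    using convergent_at_mult[of "fps_const (- 1)" x g] assms by auto
  then have "f + fps_const (- 1) * g \<in> convergent_at x"
    "fps_value (f + fps_const (- 1) * g) x = fps_value f x - fps_value g x"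
    using convergent_at_add[of f x "fps_const (- 1) * g"] assms by auto
  moreover have "f + fps_const (- 1) * g = f - g"
    by (simp add: fps_eq_iff flip: fps_const_neg)
  ultimately show "f - g \<in> convergent_at x" "fps_value (f - g) x = fps_value f x - fps_value g x"
    by simp_all
qed

section \<open>Bounds for the Gauss norm on the disk of radius 1/r\<close>

definition geom_bounded :: "real \<Rightarrow> real \<Rightarrow> 'c::complete_nonarch_field fps \<Rightarrow> bool" where
  "geom_bounded r C f \<longleftrightarrow> (\<forall>k. absval (fps_nth f k) \<le> C * r ^ k)"

lemma geom_bounded_nonneg: "geom_bounded r C f \<Longrightarrow> C \<ge> 0"
  unfolding geom_bounded_def by (metis absval_nonneg mult.right_neutral order_trans power_0)

lemma geom_bounded_const:
  assumes "r \<ge> 0"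
  shows "geom_bounded r (absval c) (fps_const c)"
  using assms by (auto simp: geom_bounded_def)

lemma geom_bounded_mult:
  assumes "geom_bounded r C f" "geom_bounded r D g" "r \<ge> 0"
  shows "geom_bounded r (C * D) (f * g)"
  unfolding geom_bounded_def
proof
  fix k
  have "absval (\<Sum>i=0..k. fps_nth f i * fps_nth g (k - i)) \<le> C * D * r ^ k"
  proof (rule absval_sum_le)
    fix i assume i: "i \<in> {0..k}"
    have "absval (fps_nth f i) * absval (fps_nth g (k - i)) \<le> (C * r ^ i) * (D * r ^ (k - i))"
      using assms geom_bounded_nonneg[OF assms(1)]
      by (intro mult_mono) (auto simp: geom_bounded_def)
    also have "\<dots> = C * D * r ^ k" using i by (simp flip: power_add)
    finally show "absval (fps_nth f i * fps_nth g (k - i)) \<le> C * D * r ^ k"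
      by (simp add: absval_mult)
  qed (use assms geom_bounded_nonneg in \<open>auto intro!: mult_nonneg_nonneg\<close>)
  then show "absval (fps_nth (f * g) k) \<le> C * D * r ^ k" by (simp add: fps_mult_nth)
qed

lemma geom_bounded_prod:
  assumes "\<And>i. i \<in> A \<Longrightarrow> geom_bounded r (C i) (f i)" "r \<ge> 0"
  shows "geom_bounded r (\<Prod>i\<in>A. C i) (\<Prod>i\<in>A. f i)"
  using assms geom_bounded_const[of r 1]
  by (induction A rule: infinite_finite_induct) (auto intro!: geom_bounded_mult)

lemma geom_bounded_power:
  assumes "geom_bounded r C f" "r \<ge> 0"
  shows "geom_bounded r (C ^ n) (f ^ n)"
  using geom_bounded_prod[of "{..<n}" r "\<lambda>_. C" "\<lambda>_. f"] assms by simp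

text \<open>The recursion for the coefficients of the inverse loses nothing: by the ultrametric
  inequality its sum is no larger than the largest summand, so the constant stays 1.\<close>

lemma geom_bounded_inverse:
  assumes f: "geom_bounded r 1 f" and f0: "fps_nth f 0 = 1" and r: "r \<ge> 0"
  shows "geom_bounded r 1 (inverse f)"
  unfolding geom_bounded_def
proof
  fix n
  let ?g = "inverse f"
  have fg: "f * ?g = 1" using f0 by (simp add: inverse_mult_eq_1')
  show "absval (fps_nth ?g n) \<le> 1 * r ^ n"
  proof (induction n rule: less_induct)
    case (less n)
    show ?case
    proof (cases "n = 0")
      case True
      then show ?thesis using f0 by simp
    next
      case False
      have "0 = fps_nth (f * ?g) n" using False fg by simp
      also have "\<dots> = fps_nth ?g n + (\<Sum>i=1..n. fps_nth f i * fps_nth ?g (n - i))"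
        by (simp add: fps_mult_nth sum.atLeast_Suc_atMost f0)
      finally have "fps_nth ?g n = - (\<Sum>i=1..n. fps_nth f i * fps_nth ?g (n - i))"
        by (simp add: eq_neg_iff_add_eq_0)
      moreover have "absval (\<Sum>i=1..n. fps_nth f i * fps_nth ?g (n - i)) \<le> r ^ n"
      proof (rule absval_sum_le)
        fix i assume i: "i \<in> {1..n}"
        have "absval (fps_nth f i) * absval (fps_nth ?g (n - i)) \<le> r ^ i * r ^ (n - i)"
          using f r i less[of "n - i"] by (intro mult_mono) (auto simp: geom_bounded_def)
        then show "absval (fps_nth f i * fps_nth ?g (n - i)) \<le> r ^ n"
          using i by (simp add: absval_mult flip: power_add)
      qed (use r in auto)
      ultimately show ?thesis by simp
    qed
  qed
qed

lemma geom_bounded_convergent_at: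
  assumes f: "geom_bounded r C f" and r: "0 \<le> r" "r * absval x < 1"
  shows "f \<in> convergent_at x"
proof -
  have "absval (fps_nth f k * x ^ k) \<le> C * (r * absval x) ^ k" for k
    using mult_right_mono[of "absval (fps_nth f k)" "C * r ^ k" "absval x ^ k"] f
    by (simp add: absval_mult absval_power geom_bounded_def power_mult_distrib mult.assoc)
  moreover have "(\<lambda>k. C * (r * absval x) ^ k) \<longlonglongrightarrow> 0"
    using r by (intro tendsto_mult_right_zero LIMSEQ_realpow_zero) auto
  ultimately have "(\<lambda>k. absval (fps_nth f k * x ^ k)) \<longlonglongrightarrow> 0"
    by (intro Lim_null_comparison[OF always_eventually, of "\<lambda>k. absval (fps_nth f k * x ^ k)"]) auto
  then show ?thesis by (simp add: convergent_at_def tendsto_absval_iff)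
qed

section \<open>The Tate algebra and comparison of coefficients\<close>

lemma tate_algebra_eq: "tate_algebra = convergent_at 1"
  by (simp add: tate_algebra_def convergent_at_def)

lemma convergent_at_mono:
  assumes "f \<in> convergent_at x" "absval y \<le> absval x"
  shows "f \<in> convergent_at y"
proof -
  have "(\<lambda>k. absval (fps_nth f k * x ^ k)) \<longlonglongrightarrow> 0"
    using assms(1) by (simp add: convergent_at_def tendsto_absval_iff)
  moreover have "absval (fps_nth f k * y ^ k) \<le> absval (fps_nth f k * x ^ k)" for k
    using assms(2) by (auto simp: absval_mult absval_power intro!: mult_left_mono power_mono)
  ultimately have "(\<lambda>k. absval (fps_nth f k * y ^ k)) \<longlonglongrightarrow> 0"
    by (intro Lim_null_comparison[OF always_eventually, of "\<lambda>k. absval (fps_nth f k * y ^ k)"]) auto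
  then show ?thesis by (simp add: convergent_at_def tendsto_absval_iff)
qed

lemma tate_algebra_eventually_less:
  assumes "f \<in> tate_algebra" "e > 0"
  shows "\<forall>\<^sub>F k in sequentially. absval (fps_nth f k) < e"
  using assms tendstoD[of "fps_nth f" 0 sequentially e] by (simp add: tate_algebra_def dist_absval)

text \<open>An eventual comparison is the form in which this is applied: coefficients of
  \<open>f\<close> and \<open>wp q f\<close> can be compared only from the index on at which those
  of \<open>f\<close> are smaller than 1.\<close>

lemma convergent_at_eventually_mono:
  assumes "g \<in> convergent_at x" "\<forall>\<^sub>F k in sequentially. absval (fps_nth f k) \<le> absval (fps_nth g k)"
  shows "f \<in> convergent_at x"
proof -
  have "(\<lambda>k. absval (fps_nth g k * x ^ k)) \<longlonglongrightarrow> 0"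
    using assms(1) by (simp add: convergent_at_def tendsto_absval_iff)
  moreover have "\<forall>\<^sub>F k in sequentially. norm (absval (fps_nth f k * x ^ k)) \<le> absval (fps_nth g k * x ^ k)"
    using assms(2) by eventually_elim (auto simp: absval_mult intro: mult_right_mono)
  ultimately have "(\<lambda>k. absval (fps_nth f k * x ^ k)) \<longlonglongrightarrow> 0"
    by (rule Lim_null_comparison[rotated])
  then show ?thesis by (simp add: convergent_at_def tendsto_absval_iff)
qed

section \<open>The Frobenius\<close>

lemma finite_field_power_card_same:
  fixes a :: "'f::{field,finite}"
  shows "a ^ CARD('f) = a"
proof (cases "a = 0")
  case False
  let ?U = "UNIV - {0::'f}"
  have "bij_betw ((*) a) ?U ?U"
    using False by (intro bij_betw_byWitness[where f' = "\<lambda>x. x / a"]) auto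
  then have "(\<Prod>x\<in>?U. a * x) = \<Prod>?U"
    by (rule prod.reindex_bij_betw)
  then have "a ^ card ?U * \<Prod>?U = \<Prod>?U"
    by (simp add: prod.distrib)
  moreover have "\<Prod>?U \<noteq> 0" by simp
  ultimately have "a ^ card ?U = 1" by simp
  moreover have "CARD('f) = Suc (card ?U)"
    by (rule card_Suc_Diff1[symmetric]) auto
  ultimately show ?thesis by (simp only: power_Suc mult_1_right)
qed (simp add: zero_power)

text \<open>The polynomial \<open>(X + 1)^q - X^q - 1\<close> has degree less than q but vanishes at all q elements.\<close>

lemma finite_field_binomial_eq_0:
  assumes "0 < k" "k < CARD('f::{field,finite})"
  shows "of_nat (CARD('f) choose k) = (0::'f)"
proof -
  let ?q = "CARD('f)"
  define p :: "'f poly" where "p = (\<Sum>k\<in>{0<..<?q}. monom (of_nat (?q choose k)) k)"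
  have split: "{..?q} = insert 0 (insert ?q {0<..<?q})" by auto
  have "poly p a = 0" for a
  proof -
    have "(a + 1) ^ ?q = (\<Sum>k\<le>?q. of_nat (?q choose k) * a ^ k)"
      by (simp add: binomial_ring)
    also have "\<dots> = 1 + (a ^ ?q + poly p a)"
      unfolding split by (subst sum.insert) (auto simp: p_def poly_sum poly_monom)
    finally show ?thesis by (simp add: finite_field_power_card_same)
  qed
  moreover have "degree p < ?q"
    unfolding p_def by (intro degree_sum_less) (auto intro: le_less_trans[OF degree_monom_le])
  ultimately have "p = 0"
    using card_poly_roots_bound[of p] by fastforce
  then have "coeff p k = 0" by simp
  then show ?thesis using assms by (simp add: p_def coeff_sum)
qed

lemma card_field_ge_2: "CARD('f::{field,finite}) \<ge> 2"
proof -
  have "card {0, 1::'f} \<le> CARD('f)" by (intro card_mono) auto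
  then show ?thesis by simp
qed

lemma fps_nth_twist [simp]: "fps_nth (twist m f) k = fps_nth f k ^ m"
  by (simp add: twist_def)

lemma twist_twist: "twist m (twist n f) = twist (n * m) f"
  by (simp add: fps_eq_iff power_mult)

text \<open>The twist would even improve the ratio to \<open>r ^ m\<close>. Keeping \<open>r\<close>
  lets all twists share one disk of convergence.\<close>

lemma geom_bounded_twist:
  assumes "geom_bounded r C f" "0 \<le> r" "r \<le> 1" "m > 0"
  shows "geom_bounded r (C ^ m) (twist m f)"
  unfolding geom_bounded_def
proof
  fix k
  have C: "C \<ge> 0" using geom_bounded_nonneg[OF assms(1)] .
  have "absval (fps_nth f k) ^ m \<le> (C * r ^ k) ^ m"
    using assms by (intro power_mono) (auto simp: geom_bounded_def)
  also have "\<dots> = C ^ m * (r ^ k) ^ m" by (simp add: power_mult_distrib)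
  also have "\<dots> \<le> C ^ m * r ^ k"
    using assms C power_decreasing[of 1 m "r ^ k"]
    by (intro mult_left_mono) (auto simp: power_le_one)
  finally show "absval (fps_nth (twist m f) k) \<le> C ^ m * r ^ k" by (simp add: absval_power)
qed

locale carlitz_setting =
  fixes \<iota> :: "'f::{field,finite} fls \<Rightarrow> 'c::complete_nonarch_field"
    and q :: nat and \<theta> \<rho> :: 'c
  assumes C_inf: "is_C_infinity \<iota>" and q_eq: "q = CARD('f)"
    and \<theta>_eq: "\<theta> = \<iota> fls_X_inv" and \<rho>_power: "\<rho> ^ (q - 1) = - \<theta>"
begin

lemma q_ge_2: "q \<ge> 2"
  unfolding q_eq by (rule card_field_ge_2)

lemma q_pos [simp]: "q > 0" and q_neq_0 [simp]: "q \<noteq> 0" and q_gt_1: "q > 1"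
  using q_ge_2 by auto

lemma iota_1 [simp]: "\<iota> 1 = 1"
  and iota_add: "\<iota> (f + g) = \<iota> f + \<iota> g"
  and iota_mult: "\<iota> (f * g) = \<iota> f * \<iota> g"
  and absval_iota: "f \<noteq> 0 \<Longrightarrow> absval (\<iota> f) = real q powi (- fls_subdegree f)"
  using C_inf by (simp_all add: is_C_infinity_def q_eq)

lemma iota_0 [simp]: "\<iota> 0 = 0"
  using iota_add[of 0 0] by (metis add_0 add_right_cancel)

lemma iota_of_nat: "\<iota> (of_nat m) = of_nat m"
  by (induction m) (auto simp: iota_add)

lemma absval_theta: "absval \<theta> = real q"
  unfolding \<theta>_eq by (simp add: absval_iota)

lemma theta_neq_0 [simp]: "\<theta> \<noteq> 0"
  using absval_theta by auto

lemma zero_power_q [simp]: "(0::'c) ^ q = 0" "(0::'c) ^ q ^ i = 0"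
  by (simp_all add: zero_power)

lemma frob_add: "(x + y :: 'c) ^ q = x ^ q + y ^ q"
proof -
  have z: "of_nat (q choose k) = (0::'c)" if "k \<in> {0<..<q}" for k
    using finite_field_binomial_eq_0[where 'f = 'f, of k] that iota_of_nat[of "q choose k"]
    by (simp add: q_eq fls_of_nat)
  have split: "{..q} = insert 0 (insert q {0<..<q})" by auto
  have "(x + y) ^ q = (\<Sum>k\<le>q. of_nat (q choose k) * x ^ k * y ^ (q - k))"
    by (rule binomial_ring)
  also have "\<dots> = y ^ q + (x ^ q + (\<Sum>k\<in>{0<..<q}. of_nat (q choose k) * x ^ k * y ^ (q - k)))"
    unfolding split by (subst sum.insert) auto
  also have "(\<Sum>k\<in>{0<..<q}. of_nat (q choose k) * x ^ k * y ^ (q - k)) = 0"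
    using z by (intro sum.neutral) auto
  finally show ?thesis by simp
qed

lemma frob_iter_add: "(x + y :: 'c) ^ q ^ i = x ^ q ^ i + y ^ q ^ i"
  by (induction i) (auto simp: power_mult frob_add mult.commute[of q])

lemma frob_sum: "(\<Sum>i\<in>A. f i :: 'c) ^ q ^ i = (\<Sum>j\<in>A. f j ^ q ^ i)"
  by (induction A rule: infinite_finite_induct) (auto simp: frob_iter_add)

lemma frob_minus: "(- x :: 'c) ^ q ^ i = - (x ^ q ^ i)"
proof -
  have "x ^ q ^ i + (- x) ^ q ^ i = 0" using frob_iter_add[of x "- x" i] by simp
  then show ?thesis by (simp add: eq_neg_iff_add_eq_0 add.commute)
qed

lemma frob_diff: "(x - y :: 'c) ^ q ^ i = x ^ q ^ i - y ^ q ^ i"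
  using frob_iter_add[of x "- y" i] by (simp add: frob_minus)

lemma frob_has_sum:
  assumes "(f has_sum (l::'c)) A"
  shows "((\<lambda>j. f j ^ q ^ i) has_sum (l ^ q ^ i)) A"
proof -
  have "((\<lambda>X. sum f X ^ q ^ i) \<longlongrightarrow> l ^ q ^ i) (finite_subsets_at_top A)"
    using assms unfolding has_sum_def by (intro tendsto_power_const)
  then show ?thesis by (simp add: has_sum_def frob_sum)
qed

abbreviation twisted :: "nat \<Rightarrow> 'c fps \<Rightarrow> 'c fps" where
  "twisted i \<equiv> twist (q ^ i)"

lemma twisted_add: "twisted i (f + g) = twisted i f + twisted i g"
  by (simp add: fps_eq_iff frob_iter_add)

lemma twisted_diff: "twisted i (f - g) = twisted i f - twisted i g"
  by (simp add: fps_eq_iff frob_diff)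

lemma twisted_mult: "twisted i (f * g) = twisted i f * twisted i g"
  by (simp add: fps_eq_iff fps_mult_nth frob_sum power_mult_distrib)

lemma twisted_const [simp]: "twisted i (fps_const c) = fps_const (c ^ q ^ i)"
  by (simp add: fps_eq_iff zero_power)

lemma twisted_1 [simp]: "twisted i 1 = 1"
  using twisted_const[of i 1] by simp

lemma twisted_0 [simp]: "twisted i 0 = 0"
  using twisted_const[of i 0] by (simp add: zero_power)

lemma twisted_X [simp]: "twisted i fps_X = fps_X"
  by (simp add: fps_eq_iff zero_power)

lemma twisted_power: "twisted i (f ^ m) = twisted i f ^ m"
  by (induction m) (auto simp: twisted_mult)

lemma twisted_prod: "twisted i (\<Prod>j\<in>A. f j) = (\<Prod>j\<in>A. twisted i (f j))"
  by (induction A rule: infinite_finite_induct) (auto simp: twisted_mult)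

lemma twisted_twisted: "twisted i (twisted j f) = twisted (i + j) f"
  by (simp add: twist_twist power_add mult.commute)

lemma twist_1 [simp]: "twist (Suc 0) f = f"
  by (simp add: fps_eq_iff)

section \<open>The function Omega\<close>

definition omega_partial :: "nat \<Rightarrow> 'c fps" where
  "omega_partial N = (\<Prod>i=1..N. 1 - fps_const (1 / \<theta> ^ (q ^ i)) * fps_X)"

text \<open>Omega without its leading constant, so that the constant coefficient is 1 and
  \<open>geom_bounded_inverse\<close> applies.\<close>

definition omega_prod :: "'c fps" where
  "omega_prod = Abs_fps (\<lambda>k. lim (\<lambda>N. fps_nth (omega_partial N) k))"

abbreviation "\<Omega> \<equiv> Omega q \<theta> \<rho>"

lemma Omega_eq: "\<Omega> = fps_const (inverse (\<rho> ^ q)) * omega_prod"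
  by (simp add: Omega_def omega_prod_def omega_partial_def)

text \<open>Omega and its inverse converge on the open disk of radius \<open>|\<theta>|^q = 1 / decay\<close>, which contains \<open>\<theta>\<close>.\<close>

definition decay :: real where
  "decay = inverse (real q ^ q)"

lemma decay_bounds: "0 \<le> decay" "decay \<le> 1" "decay * absval \<theta> < 1"
proof -
  show "0 \<le> decay" by (simp add: decay_def)
  have "real q ^ q > real q ^ 1" using q_gt_1 by (intro power_strict_increasing) auto
  then show "decay * absval \<theta> < 1"
    using q_gt_1 by (simp add: decay_def absval_theta field_simps)
  show "decay \<le> 1" using q_gt_1 by (simp add: decay_def one_le_power inverse_le_1_iff)
qed

lemma absval_theta_inverse_power_le:
  assumes "m \<le> q ^ i"
  shows "absval (1 / \<theta> ^ (q ^ i)) \<le> inverse (real q ^ m)"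
proof -
  have "real q ^ m \<le> real q ^ q ^ i"
    using assms q_gt_1 by (intro power_increasing) auto
  then have "inverse (real q ^ q ^ i) \<le> inverse (real q ^ m)"
    using q_gt_1 by (intro le_imp_inverse_le) auto
  then show ?thesis by (simp add: absval_divide absval_power absval_theta inverse_eq_divide)
qed

lemma geom_bounded_omega_partial: "geom_bounded decay 1 (omega_partial N)"
proof -
  have "geom_bounded decay 1 (1 - fps_const (1 / \<theta> ^ (q ^ i)) * fps_X)" if "i \<ge> 1" for i
    unfolding geom_bounded_def
  proof
    fix k :: nat
    have "q ^ 1 \<le> q ^ i" using that q_gt_1 by (intro power_increasing) auto
    then have "absval (1 / \<theta> ^ (q ^ i)) \<le> decay"
      unfolding decay_def by (intro absval_theta_inverse_power_le) simp
    moreover have "k = 0 \<or> k = 1 \<or> k > 1" by linarith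
    ultimately show "absval (fps_nth (1 - fps_const (1 / \<theta> ^ (q ^ i)) * fps_X) k) \<le> 1 * decay ^ k"
      using decay_bounds by auto
  qed
  then have "geom_bounded decay (\<Prod>i=1..N. 1) (omega_partial N)"
    unfolding omega_partial_def using decay_bounds by (intro geom_bounded_prod) auto
  then show ?thesis by simp
qed

text \<open>Consecutive partial products differ by \<open>t / \<theta>^(q^(N+1))\<close> times a
  series with coefficients of size at most 1. The crude estimate \<open>N \<le> q^(N+1)\<close>
  turns this into a geometric bound.\<close>

lemma omega_partial_tendsto: "(\<lambda>N. fps_nth (omega_partial N) k) \<longlonglongrightarrow> fps_nth omega_prod k"
proof -
  have b: "absval (fps_nth (omega_partial N) j) \<le> 1" for N j
    using geom_bounded_omega_partial[of N] decay_bounds power_le_one[of decay j]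
    unfolding geom_bounded_def by (metis mult_1 order_trans)
  have "absval (fps_nth (omega_partial (Suc N)) k - fps_nth (omega_partial N) k) \<le> inverse (real q) ^ N" for N
  proof -
    let ?c = "1 / \<theta> ^ (q ^ Suc N)"
    have "omega_partial (Suc N) = omega_partial N - fps_const ?c * (fps_X * omega_partial N)"
      unfolding omega_partial_def by (simp add: algebra_simps)
    then have "absval (fps_nth (omega_partial (Suc N)) k - fps_nth (omega_partial N) k)
       = absval ?c * absval (fps_nth (fps_X * omega_partial N) k)"
      by (simp add: absval_mult absval_divide del: fps_X_mult_nth power_Suc)
    also have "\<dots> \<le> inverse (real q ^ N) * 1"
    proof (intro mult_mono absval_theta_inverse_power_le)
      show "N \<le> q ^ Suc N"
        using less_exp[of "Suc N"] power_mono[of 2 q "Suc N"] q_ge_2 by linarith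
    qed (use b in auto)
    finally show ?thesis by (simp add: power_inverse)
  qed
  moreover have "(\<lambda>N. inverse (real q) ^ N) \<longlonglongrightarrow> 0"
    using q_gt_1 by (intro LIMSEQ_realpow_zero) (auto simp: inverse_less_1_iff)
  ultimately have "(\<lambda>N. absval (fps_nth (omega_partial (Suc N)) k - fps_nth (omega_partial N) k)) \<longlonglongrightarrow> 0"
    by (intro Lim_null_comparison[OF always_eventually,
          of "\<lambda>N. absval (fps_nth (omega_partial (Suc N)) k - fps_nth (omega_partial N) k)"]) auto
  then have "convergent (\<lambda>N. fps_nth (omega_partial N) k)"
    by (intro telescope_convergent) (simp add: tendsto_absval_iff)
  then show ?thesis by (simp add: omega_prod_def convergent_LIMSEQ_iff)
qed

lemma geom_bounded_omega_prod: "geom_bounded decay 1 omega_prod"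
  unfolding geom_bounded_def
proof
  fix k
  have "fps_nth omega_prod k \<in> {x. absval x \<le> 1 * decay ^ k}"
    by (rule Lim_in_closed_set[OF closed_absval_le _ _ omega_partial_tendsto])
       (use geom_bounded_omega_partial in \<open>auto simp: geom_bounded_def\<close>)
  then show "absval (fps_nth omega_prod k) \<le> 1 * decay ^ k" by simp
qed

lemma omega_prod_nth_0: "fps_nth omega_prod 0 = 1"
proof -
  have "fps_nth (omega_partial N) 0 = 1" for N
    by (induction N) (auto simp: omega_partial_def)
  then show ?thesis
    using omega_partial_tendsto[of 0] by (simp add: LIMSEQ_const_iff)
qed

text \<open>Twisting raises the index of every factor by one, so the twisted product lacks exactly
  the factor with index 1. This holds for the partial products and passes to the limit in each
  coefficient.\<close>

lemma omega_prod_eq: "omega_prod = (1 - fps_const (1 / \<theta> ^ q) * fps_X) * twist q omega_prod"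
proof (rule fps_ext)
  fix k
  let ?c = "1 / \<theta> ^ q"
  have "omega_partial (Suc N) = (1 - fps_const ?c * fps_X) * twist q (omega_partial N)" for N
  proof -
    have "omega_partial (Suc N) = (1 - fps_const ?c * fps_X) *
        (\<Prod>i=1..N. 1 - fps_const (1 / \<theta> ^ (q ^ Suc i)) * fps_X)"
      unfolding omega_partial_def
      by (simp only: One_nat_def prod.atLeast_Suc_atMost_Suc_shift prod.atLeast_Suc_atMost[OF le0]) simp
    also have "(\<Prod>i=1..N. 1 - fps_const (1 / \<theta> ^ (q ^ Suc i)) * fps_X) = twisted 1 (omega_partial N)"
      unfolding omega_partial_def twisted_prod
      by (intro prod.cong refl)
         (simp add: twisted_diff[of 1, simplified] twisted_mult[of 1, simplified] twisted_const[of 1, simplified]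
           twisted_1[of 1, simplified] twisted_X[of 1, simplified]
           power_divide mult.commute[of q] flip: power_mult)
    finally show ?thesis by simp
  qed
  then have "(\<lambda>N. fps_nth ((1 - fps_const ?c * fps_X) * twist q (omega_partial N)) k) \<longlonglongrightarrow> fps_nth omega_prod k"
    using LIMSEQ_Suc[OF omega_partial_tendsto[of k]] by simp
  moreover have "(\<lambda>N. fps_nth ((1 - fps_const ?c * fps_X) * twist q (omega_partial N)) k) \<longlonglongrightarrow>
     fps_nth ((1 - fps_const ?c * fps_X) * twist q omega_prod) k"
    unfolding fps_mult_nth fps_nth_twist
    by (intro tendsto_sum tendsto_mult tendsto_const tendsto_power_const omega_partial_tendsto)
  ultimately show "fps_nth omega_prod k = fps_nth ((1 - fps_const ?c * fps_X) * twist q omega_prod) k"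
    using LIMSEQ_unique by blast
qed

lemma rho_neq_0 [simp]: "\<rho> \<noteq> 0"
  using \<rho>_power q_gt_1 by (auto simp: zero_power)

text \<open>This is what the leading constant \<open>\<rho>^(-q)\<close> is made for. Its twist is
  \<open>\<rho>^(-q^2)\<close>, and \<open>\<rho>^(q(q-1)) = (-\<theta>)^q = -\<theta>^q\<close>, so
  the quotient of the two constants turns \<open>1 - t/\<theta>^q\<close> into
  \<open>t - \<theta>^q\<close>.\<close>

lemma Omega_functional_equation: "\<Omega> = (fps_X - fps_const (\<theta> ^ q)) * twisted 1 \<Omega>"
proof -
  have "\<rho> ^ (q * q) = \<rho> ^ (q * (q - 1)) * \<rho> ^ q"
  proof -
    have "q * q = q * (q - 1) + q" using q_pos by (cases q) auto
    then show ?thesis by (simp only: power_add)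
  qed
  also have "\<rho> ^ (q * (q - 1)) = - (\<theta> ^ q)"
    using \<rho>_power frob_minus[of \<theta> 1] by (simp add: power_mult mult.commute[of q])
  finally have "inverse (\<rho> ^ q) = - (\<theta> ^ q) * inverse (\<rho> ^ (q * q))"
    by (simp add: field_simps)
  moreover have "inverse (\<rho> ^ q) ^ q ^ 1 = inverse (\<rho> ^ (q * q))"
    by (simp add: power_inverse flip: power_mult)
  ultimately have c: "fps_const (inverse (\<rho> ^ q)) = fps_const (- (\<theta> ^ q)) * fps_const (inverse (\<rho> ^ q) ^ q ^ 1)"
    unfolding fps_const_mult by argo
  have X: "fps_X - fps_const (\<theta> ^ q) = fps_const (- (\<theta> ^ q)) * (1 - fps_const (1 / \<theta> ^ q) * fps_X)"
    by (simp add: fps_eq_iff)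
  have "\<Omega> = fps_const (- (\<theta> ^ q)) * fps_const (inverse (\<rho> ^ q) ^ q ^ 1) *
      ((1 - fps_const (1 / \<theta> ^ q) * fps_X) * twisted 1 omega_prod)"
    unfolding Omega_eq using c omega_prod_eq by simp
  also have "\<dots> = (fps_X - fps_const (\<theta> ^ q)) * twisted 1 \<Omega>"
    unfolding X Omega_eq twisted_mult twisted_const by (simp only: mult_ac)
  finally show ?thesis .
qed

lemma twisted_Omega: "twisted i \<Omega> = (fps_X - fps_const (\<theta> ^ (q ^ Suc i))) * twisted (Suc i) \<Omega>"
proof -
  have "twisted i \<Omega> = twisted i ((fps_X - fps_const (\<theta> ^ q)) * twisted 1 \<Omega>)"
    by (subst Omega_functional_equation) simp
  also have "\<dots> = (fps_X - fps_const ((\<theta> ^ q) ^ q ^ i)) * twisted (i + 1) \<Omega>"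
    unfolding twisted_mult twisted_diff twisted_X twisted_const twisted_twisted ..
  finally show ?thesis by (simp flip: power_mult)
qed

text \<open>The size of the leading constant, hence the Gauss norm bound of Omega. By
  \<open>omega_eq_powr\<close> it is the number \<open>q^(-q/(q-1))\<close> whose powers appear in
  \<open>convergence_region\<close>.\<close>

definition \<omega> :: real where
  "\<omega> = inverse (absval \<rho> ^ q)"

lemma geom_bounded_Omega: "geom_bounded decay \<omega> \<Omega>"
  using geom_bounded_mult[OF geom_bounded_const geom_bounded_omega_prod, of "inverse (\<rho> ^ q)"] decay_bounds
  by (simp add: Omega_eq \<omega>_def absval_inverse absval_power)

lemma omega_eq_powr: "\<omega> = real q powr (- (real q / (real q - 1)))"
proof -
  have "absval \<rho> ^ (q - 1) = real q"
    using \<rho>_power absval_theta by (metis absval_minus absval_power)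
  then have "absval \<rho> powr (real q - 1) = real q"
    using q_gt_1 by (simp add: of_nat_diff flip: powr_realpow)
  then have "real q powr (1 / (real q - 1)) = absval \<rho> powr ((real q - 1) * (1 / (real q - 1)))"
    by (simp only: powr_powr[symmetric])
  also have "\<dots> = absval \<rho>" using q_gt_1 by simp
  finally have "absval \<rho> = real q powr (1 / (real q - 1))" ..
  then have "absval \<rho> ^ q = real q powr (real q / (real q - 1))"
    using q_gt_1 by (simp add: powr_powr flip: powr_realpow)
  then show ?thesis by (simp add: \<omega>_def powr_minus)
qed

lemma convergent_at_twisted_Omega: "twisted i \<Omega> \<in> convergent_at \<theta>"
  using geom_bounded_twist[OF geom_bounded_Omega, of "q ^ i"] decay_bounds geom_bounded_convergent_at
  by simp

lemma convergent_at_Omega [simp]: "\<Omega> \<in> convergent_at \<theta>"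
  using geom_bounded_Omega decay_bounds geom_bounded_convergent_at by blast

lemma convergent_at_inverse_Omega [simp]: "inverse \<Omega> \<in> convergent_at \<theta>"
proof -
  have "inverse omega_prod \<in> convergent_at \<theta>"
    using geom_bounded_inverse[OF geom_bounded_omega_prod omega_prod_nth_0] decay_bounds
      geom_bounded_convergent_at by blast
  then show ?thesis
    unfolding Omega_eq fps_inverse_mult by (simp add: fps_const_inverse convergent_at_mult)
qed

lemma fps_value_inverse_Omega: "fps_value (inverse \<Omega>) \<theta> = pi_tilde q \<theta> \<rho>"
  and fps_value_Omega_neq_0: "fps_value \<Omega> \<theta> \<noteq> 0"
proof -
  have "fps_nth \<Omega> 0 \<noteq> 0" by (simp add: Omega_eq omega_prod_nth_0)
  then have "inverse \<Omega> * \<Omega> = 1" by (rule inverse_mult_eq_1)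
  then have *: "fps_value (inverse \<Omega>) \<theta> * fps_value \<Omega> \<theta> = 1"
    using convergent_at_mult(2)[of "inverse \<Omega>" \<theta> \<Omega>] by simp
  then show "fps_value \<Omega> \<theta> \<noteq> 0" by auto
  with * show "fps_value (inverse \<Omega>) \<theta> = pi_tilde q \<theta> \<rho>" by (simp add: pi_tilde_def field_simps)
qed

lemma pi_tilde_neq_0: "pi_tilde q \<theta> \<rho> \<noteq> 0"
  using fps_value_Omega_neq_0 by (simp add: pi_tilde_def)

lemma theta_power_neq: "k \<ge> 1 \<Longrightarrow> \<theta> - \<theta> ^ (q ^ k) \<noteq> 0"
proof
  assume k: "k \<ge> 1" and "\<theta> - \<theta> ^ (q ^ k) = 0"
  then have "absval \<theta> = absval \<theta> ^ (q ^ k)" by (metis absval_power eq_iff_diff_eq_0)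
  moreover have "q ^ k > 1" using k q_gt_1 by (intro one_less_power) auto
  then have "real q ^ 1 < real q ^ q ^ k"
    using q_gt_1 by (intro power_strict_increasing) auto
  ultimately show False by (simp add: absval_theta)
qed

text \<open>The twist leaves t alone, so this is not a Frobenius power of
  \<open>fps_value \<Omega> \<theta>\<close>. Evaluating \<open>twisted_Omega\<close> at
  \<open>t = \<theta>\<close> shows that each further twist divides the value by one factor of
  \<open>carlitz_L\<close>.\<close>

lemma fps_value_twisted_Omega: "fps_value (twisted i \<Omega>) \<theta> = fps_value \<Omega> \<theta> / carlitz_L q \<theta> i"
proof (induction i)
  case 0
  then show ?case by (simp add: carlitz_L_def)
next
  case (Suc i)
  have X: "fps_X - fps_const (\<theta> ^ (q ^ Suc i)) \<in> convergent_at \<theta>"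
    "fps_value (fps_X - fps_const (\<theta> ^ (q ^ Suc i))) \<theta> = \<theta> - \<theta> ^ (q ^ Suc i)"
    by (simp_all add: convergent_at_diff)
  have "fps_value (twisted i \<Omega>) \<theta> = (\<theta> - \<theta> ^ (q ^ Suc i)) * fps_value (twisted (Suc i) \<Omega>) \<theta>"
    using convergent_at_mult(2)[OF X(1) convergent_at_twisted_Omega[of "Suc i"]] X(2)
    by (simp only: twisted_Omega[of i])
  then have "fps_value (twisted (Suc i) \<Omega>) \<theta> = fps_value (twisted i \<Omega>) \<theta> / (\<theta> - \<theta> ^ (q ^ Suc i))"
    using theta_power_neq[of "Suc i"] by (simp del: power_Suc)
  moreover have "carlitz_L q \<theta> (Suc i) = carlitz_L q \<theta> i * (\<theta> - \<theta> ^ (q ^ Suc i))"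
    by (simp add: carlitz_L_def)
  ultimately show ?case
    using Suc by (simp only: divide_divide_eq_left)
qed

section \<open>The operator wp\<close>

lemma convergent_at_theta_tate: "f \<in> convergent_at \<theta> \<Longrightarrow> f \<in> tate_algebra"
  unfolding tate_algebra_eq by (rule convergent_at_mono) (use q_gt_1 absval_theta in auto)

lemma wp_diff: "wp q (f - g) = wp q f - wp q (g :: 'c fps)"
  using twisted_diff[of 1 f g] by (simp add: wp_def)

text \<open>The solution is \<open>y + y^q + y^(q^2) + ...\<close>: its q-th power is the same
  series without the first term, and the first term is the largest.\<close>

lemma artin_schreier_small:
  assumes "absval (y::'c) < 1"
  shows "\<exists>x. x - x ^ q = y \<and> absval x \<le> absval y"
proof -
  define a where "a = (\<lambda>k. y ^ q ^ k)"
  have le: "absval (a k) \<le> absval y ^ k" for k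
  proof -
    have "k \<le> q ^ k" using less_exp[of k] power_mono[of 2 q k] q_ge_2 by linarith
    then show ?thesis unfolding a_def absval_power using assms by (intro power_decreasing) auto
  qed
  have "(\<lambda>k. absval y ^ k) \<longlonglongrightarrow> 0" using assms by (intro LIMSEQ_realpow_zero) auto
  with le have "(\<lambda>k. absval (a k)) \<longlonglongrightarrow> 0"
    by (intro Lim_null_comparison[OF always_eventually, of "\<lambda>k. absval (a k)"]) auto
  then have hs: "(a has_sum suminf a) UNIV"
    by (intro null_seq_has_sum) (simp add: tendsto_absval_iff)
  then have lim: "(\<lambda>n. \<Sum>k<n. a k) \<longlonglongrightarrow> suminf a"
    using has_sum_imp_sums unfolding sums_def by blast
  have "(\<Sum>k<Suc n. a k) = y + (\<Sum>k<n. a k) ^ q" for n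
    unfolding sum.lessThan_Suc_shift using frob_sum[of a "{..<n}" 1]
    by (simp add: a_def mult.commute[of q] flip: power_mult)
  moreover have "(\<lambda>n. y + (\<Sum>k<n. a k) ^ q) \<longlonglongrightarrow> y + suminf a ^ q"
    by (intro tendsto_add tendsto_const tendsto_power_const lim)
  ultimately have "suminf a = y + suminf a ^ q"
    using LIMSEQ_Suc[OF lim] LIMSEQ_unique by auto
  moreover have "absval (suminf a) \<le> absval y"
  proof (rule has_sum_absval_le[OF hs])
    fix k
    have "absval y ^ q ^ k \<le> absval y ^ 1"
      using assms q_gt_1 by (intro power_decreasing) (auto intro: one_le_power)
    then show "absval (a k) \<le> absval y" by (simp add: a_def absval_power)
  qed simp
  ultimately show ?thesis by (intro exI[of _ "suminf a"]) (auto simp: algebra_simps)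
qed

lemma iota_algebraic: "\<iota> c \<in> algebraic_over \<iota>"
proof -
  have "\<iota> (- c) + \<iota> c = 0" using iota_add[of "- c" c] by simp
  then have "poly (map_poly \<iota> [:- c, 1:]) (\<iota> c) = 0" by (simp add: map_poly_pCons)
  moreover have "[:- c, 1:] \<noteq> 0" by simp
  ultimately show ?thesis unfolding algebraic_over_def by blast
qed

text \<open>\<open>is_C_infinity\<close> provides roots only for polynomials with coefficients
  algebraic over the Laurent series field. So \<open>y\<close> is first replaced by an algebraic
  \<open>y'\<close> at distance less than 1, the equation is solved for \<open>y'\<close> by a root
  of \<open>X^q - X + y'\<close>, and \<open>artin_schreier_small\<close> accounts for
  \<open>y - y'\<close>. The two solutions add up because the Frobenius is additive.\<close>

lemma artin_schreier: "\<exists>x. x - x ^ q = (y::'c)"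
proof -
  have "y \<in> closure (algebraic_over \<iota>)"
    using C_inf by (simp add: is_C_infinity_def)
  then obtain y' where y': "y' \<in> algebraic_over \<iota>" "dist y' y < 1"
    unfolding closure_approachable using zero_less_one by blast
  define p where "p = monom 1 q + [:y', - 1:]"
  have co: "coeff p i = (if i = q then 1 else 0) + coeff [:y', - 1:] i" for i
    by (simp add: p_def)
  have m1: "- 1 \<in> algebraic_over \<iota>"
  proof -
    have "\<iota> (- 1) + 1 = 0" using iota_add[of "- 1" 1] by simp
    then have "\<iota> (- 1) = - 1" by (simp only: eq_neg_iff_add_eq_0)
    then show ?thesis using iota_algebraic[of "- 1"] by simp
  qed
  have "coeff p i \<in> algebraic_over \<iota>" for i
  proof -
    consider "i = 0" | "i = 1" | "i > 1" by linarith
    then show ?thesis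
      using q_ge_2 iota_algebraic[of 0] iota_algebraic[of 1] y'(1) m1
      by cases (auto simp: co coeff_pCons split: nat.splits)
  qed
  moreover have "degree p > 0"
  proof -
    have "coeff p q \<noteq> 0" using q_ge_2 by (auto simp: co coeff_pCons split: nat.splits)
    then show ?thesis using le_degree[of p q] q_pos by linarith
  qed
  ultimately obtain x where x: "poly p x = 0"
    using C_inf[unfolded is_C_infinity_def, THEN conjunct2, THEN conjunct2, THEN conjunct2,
        THEN conjunct2, THEN conjunct1, THEN spec, of p] by blast
  then have x': "x - x ^ q = y'" by (simp add: p_def poly_monom algebra_simps add_eq_0_iff)
  obtain u where u: "u - u ^ q = y - y'"
    using artin_schreier_small[of "y - y'"] y'(2) by (auto simp: dist_absval absval_minus_commute)
  have "(x + u) - (x + u) ^ q = (x - x ^ q) + (u - u ^ q)" by (simp add: frob_add)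
  then have "(x + u) - (x + u) ^ q = y" by (simp add: x' u)
  then show ?thesis by blast
qed

text \<open>Solving the equation in every coefficient is not enough, since a solution may be altered
  by any constant from F_q. The small solution has to be taken wherever the coefficient of
  \<open>Y\<close> is below 1, so that the result stays in the Tate algebra.\<close>

lemma wp_surj:
  assumes "Y \<in> tate_algebra"
  obtains F :: "'c fps" where "F \<in> tate_algebra" "wp q F = Y"
proof -
  have "\<forall>i. \<exists>x. x - x ^ q = fps_nth Y i \<and> (absval (fps_nth Y i) < 1 \<longrightarrow> absval x \<le> absval (fps_nth Y i))"
    using artin_schreier_small artin_schreier by blast
  then obtain x where x: "\<And>i. x i - x i ^ q = fps_nth Y i"
    "\<And>i. absval (fps_nth Y i) < 1 \<Longrightarrow> absval (x i) \<le> absval (fps_nth Y i)" by metis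
  show ?thesis
  proof
    show "wp q (Abs_fps x) = Y" by (simp add: fps_eq_iff wp_def x)
    show "Abs_fps x \<in> tate_algebra" unfolding tate_algebra_eq
    proof (rule convergent_at_eventually_mono)
      show "Y \<in> convergent_at 1" using assms by (simp add: tate_algebra_eq)
      show "\<forall>\<^sub>F k in sequentially. absval (fps_nth (Abs_fps x) k) \<le> absval (fps_nth Y k)"
        using tate_algebra_eventually_less[OF assms zero_less_one]
        by eventually_elim (simp add: x)
    qed
  qed
qed

text \<open>A coefficient \<open>x\<close> with \<open>0 < |x| < 1\<close> dominates
  \<open>x^q\<close>, so \<open>x - x^q\<close> has the same size.\<close>

lemma wp_convergent_at:
  assumes "F \<in> tate_algebra" "wp q F \<in> convergent_at \<theta>"
  shows "F \<in> convergent_at \<theta>"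
proof (rule convergent_at_eventually_mono[OF assms(2)])
  show "\<forall>\<^sub>F k in sequentially. absval (fps_nth F k) \<le> absval (fps_nth (wp q F) k)"
    using tate_algebra_eventually_less[OF assms(1) zero_less_one]
  proof eventually_elim
    case (elim k)
    let ?x = "fps_nth F k"
    show ?case
    proof (cases "?x = 0")
      case False
      then have "absval ?x ^ q < absval ?x ^ 1"
        using elim q_gt_1 by (intro power_strict_decreasing) auto
      then have "absval (- (?x ^ q)) < absval ?x" by (simp add: absval_power)
      from absval_eq_of_dominant[OF this] show ?thesis by (simp add: wp_def)
    qed simp
  qed
qed

lemma twist_convergent_at:
  assumes "F \<in> convergent_at \<theta>"
  shows "twist q F \<in> convergent_at \<theta>"
proof (rule convergent_at_eventually_mono[OF assms])
  show "\<forall>\<^sub>F k in sequentially. absval (fps_nth (twist q F) k) \<le> absval (fps_nth F k)"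
    using tate_algebra_eventually_less[OF convergent_at_theta_tate[OF assms] zero_less_one]
  proof eventually_elim
    case (elim k)
    then have "absval (fps_nth F k) ^ q \<le> absval (fps_nth F k) ^ 1"
      using q_gt_1 by (intro power_decreasing) auto
    then show ?case by (simp add: absval_power)
  qed
qed

lemma solution_convergent:
  assumes F: "solves_system q m Y F" and Y: "\<And>i. i \<in> {1..m} \<Longrightarrow> Y i \<in> convergent_at \<theta>"
    and "i \<le> m"
  shows "F i \<in> convergent_at \<theta>"
  using \<open>i \<le> m\<close>
proof (induction i)
  case 0
  then show ?case using F by (simp add: solves_system_def)
next
  case (Suc i)
  then have "F (Suc i) \<in> tate_algebra" "wp q (F (Suc i)) = Y (m - Suc i + 1) * twist q (F i)"
    using F[unfolded solves_system_def, THEN conjunct2, THEN bspec, of "Suc i"] by simp_all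
  moreover have "Y (m - Suc i + 1) * twist q (F i) \<in> convergent_at \<theta>"
    by (rule convergent_at_mult(1)[OF Y twist_convergent_at]) (use Suc in auto)
  ultimately show ?case using wp_convergent_at[of "F (Suc i)"] by simp
qed

lemma solution_exists:
  assumes Y: "\<And>i. i \<in> {1..m} \<Longrightarrow> Y i \<in> convergent_at \<theta>"
  obtains F where "solves_system q m Y F"
proof -
  \<comment> \<open>The induction is on the number j of equations already solved, with the depth m
    fixed, because the coefficient in equation i depends on m.\<close>
  have "\<exists>F. F 0 = 1 \<and> (\<forall>i\<in>{1..j}. F i \<in> convergent_at \<theta> \<and> wp q (F i) = Y (m - i + 1) * twist q (F (i - 1)))"
    if "j \<le> m" for j
    using that
  proof (induction j)
    case 0
    then show ?case by (intro exI[of _ "\<lambda>_. 1"]) auto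
  next
    case (Suc j)
    obtain F where F: "F 0 = 1"
      "\<And>i. i \<in> {1..j} \<Longrightarrow> F i \<in> convergent_at \<theta> \<and> wp q (F i) = Y (m - i + 1) * twist q (F (i - 1))"
      using Suc.IH[OF Suc_leD[OF Suc.prems]] by (elim exE conjE) (rule that, assumption, rule bspec)
    have "F j \<in> convergent_at \<theta>" using F by (cases "j = 0") auto
    then have R: "Y (m - Suc j + 1) * twist q (F j) \<in> convergent_at \<theta>"
      by (intro convergent_at_mult(1)[OF Y twist_convergent_at]) (use Suc.prems in auto)
    then obtain f where f: "f \<in> tate_algebra" "wp q f = Y (m - Suc j + 1) * twist q (F j)"
      using wp_surj[OF convergent_at_theta_tate[OF R]] by blast
    then have "f \<in> convergent_at \<theta>" using R wp_convergent_at[of f] by simp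
    then have "\<forall>i\<in>{1..Suc j}. (F(Suc j := f)) i \<in> convergent_at \<theta> \<and>
        wp q ((F(Suc j := f)) i) = Y (m - i + 1) * twist q ((F(Suc j := f)) (i - 1))"
      using f F(2) by (auto simp: le_Suc_eq)
    then show ?case using F(1) by (intro exI[of _ "F(Suc j := f)"]) auto
  qed
  from this[OF order_refl] obtain F where "F 0 = 1"
    "\<forall>i\<in>{1..m}. F i \<in> convergent_at \<theta> \<and> wp q (F i) = Y (m - i + 1) * twist q (F (i - 1))" by blast
  then have "solves_system q m Y F"
    by (simp add: solves_system_def convergent_at_theta_tate)
  then show thesis by (rule that)
qed

subsection \<open>The kernel of wp\<close>

definition const_emb :: "'f \<Rightarrow> 'c" where
  "const_emb a = \<iota> (fls_const a)"

lemma const_emb_0 [simp]: "const_emb 0 = 0" and const_emb_1 [simp]: "const_emb 1 = 1"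
  by (simp_all add: const_emb_def)

lemma const_emb_add: "const_emb (a + b) = const_emb a + const_emb b"
  by (simp add: const_emb_def flip: fls_plus_const iota_add)

lemma const_emb_minus: "const_emb (- a) = - const_emb a"
  using const_emb_add[of "- a" a] by (simp add: eq_neg_iff_add_eq_0)

lemma const_emb_power: "const_emb (a ^ k) = const_emb a ^ k"
  by (induction k) (auto simp: const_emb_def iota_mult simp flip: fls_const_mult_const)

lemma absval_const_emb: "a \<noteq> 0 \<Longrightarrow> absval (const_emb a) = 1"
  by (simp add: const_emb_def absval_iota)

lemma const_emb_eq_0_iff [simp]: "const_emb a = 0 \<longleftrightarrow> a = 0"
  using absval_const_emb[of a] by force

lemma inj_const_emb: "inj const_emb"
proof (rule injI)
  fix a b assume "const_emb a = const_emb b"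
  then have "const_emb (a + - b) = 0" unfolding const_emb_add const_emb_minus by simp
  then show "a = b" by (simp del: add_uminus_conv_diff add: eq_neg_iff_add_eq_0[symmetric])
qed

text \<open>\<open>X^q - X\<close> has at most q roots, and the q constants are roots
  already.\<close>

lemma frobenius_fixed: "x ^ q = x \<Longrightarrow> x \<in> range const_emb"
proof -
  let ?p = "monom 1 q + [:0, - 1:] :: 'c poly"
  have "coeff ?p q = 1" using q_ge_2 by (auto simp: coeff_pCons split: nat.splits)
  then have p: "?p \<noteq> 0" by (metis coeff_0 zero_neq_one)
  have "degree ?p \<le> q"
    using q_ge_2 by (intro degree_add_le) (auto simp: degree_monom_eq)
  then have "card {x. poly ?p x = 0} \<le> q" using card_poly_roots_bound[OF p] by linarith
  then have "card {x. poly ?p x = 0} \<le> card (range const_emb)"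
    by (simp add: card_image[OF inj_const_emb] q_eq)
  moreover have "range const_emb \<subseteq> {x. poly ?p x = 0}"
    by (auto simp: poly_monom q_eq finite_field_power_card_same simp flip: const_emb_power)
  ultimately have "range const_emb = {x. poly ?p x = 0}"
    using poly_roots_finite[OF p] by (intro card_seteq)
  then show "x ^ q = x \<Longrightarrow> x \<in> range const_emb" by (simp add: poly_monom)
qed

text \<open>All coefficients lie in F_q, where nonzero elements have absolute value 1; a null
  sequence of such elements is eventually 0.\<close>

lemma fixed_tate_polynomial:
  assumes "f \<in> tate_algebra" "wp q f = 0"
  obtains p :: "'f poly" where "f = Abs_fps (\<lambda>k. const_emb (coeff p k))"
proof -
  have "fps_nth f k ^ q = fps_nth f k" for k
    using assms(2) by (auto simp: wp_def fps_eq_iff)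
  then have "\<exists>a. fps_nth f k = const_emb a" for k using frobenius_fixed by blast
  then obtain c where c: "\<And>k. fps_nth f k = const_emb (c k)" by metis
  obtain N where N: "\<And>k. k \<ge> N \<Longrightarrow> absval (fps_nth f k) < 1"
    using tate_algebra_eventually_less[OF assms(1) zero_less_one] by (auto simp: eventually_sequentially)
  have "c k = 0" if "k \<ge> N" for k
    using N[OF that] absval_const_emb[of "c k"] c[of k] by auto
  then have "f = Abs_fps (\<lambda>k. const_emb (coeff (\<Sum>j<N. monom (c j) j) k))"
    by (simp add: fps_eq_iff c coeff_sum)
  then show thesis by (rule that)
qed

section \<open>The ring A as the values of F_q[t] at theta\<close>

definition A_value :: "'f poly \<Rightarrow> 'c" where
  "A_value p = poly (map_poly const_emb p) \<theta>"

lemma ring_A_eq: "ring_A \<iota> = range A_value"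
  unfolding ring_A_def A_value_def const_emb_def \<theta>_eq[symmetric] ..

lemma A_value_altdef:
  assumes "degree p \<le> N"
  shows "A_value p = (\<Sum>k\<le>N. const_emb (coeff p k) * \<theta> ^ k)"
proof -
  have "A_value p = (\<Sum>k\<le>degree p. const_emb (coeff p k) * \<theta> ^ k)"
    unfolding A_value_def poly_altdef by (subst degree_map_poly) (auto simp: coeff_map_poly)
  also have "\<dots> = (\<Sum>k\<le>N. const_emb (coeff p k) * \<theta> ^ k)"
    using assms by (intro sum.mono_neutral_left) (auto simp: coeff_eq_0)
  finally show ?thesis .
qed

lemma A_value_add: "A_value (p1 + p2) = A_value p1 + A_value p2"
proof -
  let ?N = "max (degree p1) (degree p2)"
  show ?thesis
    using A_value_altdef[of p1 ?N] A_value_altdef[of p2 ?N] A_value_altdef[of "p1 + p2" ?N]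
    by (simp add: degree_add_le_max const_emb_add algebra_simps sum.distrib)
qed

lemma A_value_minus: "A_value (- p) = - A_value p"
proof -
  have "A_value (- p) + A_value p = 0" by (simp flip: A_value_add) (simp add: A_value_def)
  then show ?thesis by (simp add: eq_neg_iff_add_eq_0)
qed

lemma ring_A_add: "a \<in> ring_A \<iota> \<Longrightarrow> b \<in> ring_A \<iota> \<Longrightarrow> a + b \<in> ring_A \<iota>"
  by (auto simp: ring_A_eq simp flip: A_value_add)

lemma ring_A_minus: "a \<in> ring_A \<iota> \<Longrightarrow> - a \<in> ring_A \<iota>"
  by (auto simp: ring_A_eq simp flip: A_value_minus)

lemma ring_A_0: "0 \<in> ring_A \<iota>"
  unfolding ring_A_eq by (rule image_eqI[of _ _ 0]) (simp_all add: A_value_def)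

lemma fps_polynomial_value:
  "Abs_fps (\<lambda>k. const_emb (coeff p k)) \<in> convergent_at \<theta>"
  "fps_value (Abs_fps (\<lambda>k. const_emb (coeff p k))) \<theta> = A_value p"
  using convergent_at_polynomial[of "degree p" "Abs_fps (\<lambda>k. const_emb (coeff p k))" \<theta>]
  by (auto simp: coeff_eq_0 A_value_altdef[OF order_refl])

text \<open>The leading term has size \<open>q ^ degree p\<close> and strictly dominates the sum of
  the lower ones.\<close>

lemma absval_ring_A_ge_1:
  assumes "a \<in> ring_A \<iota>" "a \<noteq> 0"
  shows "absval a \<ge> 1"
proof -
  obtain p where p: "a = A_value p" using assms by (auto simp: ring_A_eq)
  with assms have "p \<noteq> 0" by (auto simp: A_value_def)
  let ?n = "degree p" and ?t = "\<lambda>k. const_emb (coeff p k) * \<theta> ^ k"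
  have lead: "absval (?t ?n) = real q ^ ?n"
    using \<open>p \<noteq> 0\<close> by (simp add: absval_mult absval_power absval_theta absval_const_emb)
  have "absval (\<Sum>k<?n. ?t k) < absval (?t ?n)"
    unfolding lead
  proof (rule absval_sum_less)
    fix k assume "k \<in> {..<?n}"
    then have "real q ^ k < real q ^ ?n"
      using q_gt_1 by (intro power_strict_increasing) auto
    then show "absval (?t k) < real q ^ ?n"
      by (cases "coeff p k = 0") (auto simp: absval_mult absval_power absval_theta absval_const_emb)
  qed simp
  from absval_eq_of_dominant[OF this] have "absval a = real q ^ ?n"
    using lead by (simp add: p A_value_altdef[of p ?n] add.commute flip: lessThan_Suc_atMost)
  then show ?thesis using q_gt_1 by (simp add: one_le_power)
qed

end

section \<open>The monodromy module\<close>

text \<open>For \<open>k < d\<close> the systems solved by \<open>G k\<close> involve only the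
  arguments 1 to d-1, so the one module M serves every \<open>z(d := zd)\<close>.\<close>

locale monodromy_setting = carlitz_setting \<iota> q \<theta> \<rho>
  for \<iota> :: "'f::{field,finite} fls \<Rightarrow> 'c::complete_nonarch_field"
    and q :: nat and \<theta> \<rho> :: 'c +
  fixes d :: nat and n :: "nat \<Rightarrow> nat" and z :: "nat \<Rightarrow> 'c"
    and G :: "nat \<Rightarrow> nat \<Rightarrow> 'c fps" and M :: "(nat \<Rightarrow> 'c) set"
  assumes d_ge_1: "d \<ge> 1"
    and G: "\<And>k. k < d \<Longrightarrow> solves_system q k (system_coeffs q \<theta> \<rho> n z) (G k)"
    and M_eq: "M = monodromy_module \<iota> \<rho> d n G"
begin

abbreviation Ys :: "(nat \<Rightarrow> 'c) \<Rightarrow> nat \<Rightarrow> 'c fps" where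
  "Ys \<equiv> system_coeffs q \<theta> \<rho> n"

abbreviation w :: nat where
  "w \<equiv> \<Sum>i=1..d. n i"

abbreviation \<pi> :: 'c where
  "\<pi> \<equiv> pi_tilde q \<theta> \<rho>"

lemma Ys_convergent [simp]: "Ys x i \<in> convergent_at \<theta>"
  by (simp add: system_coeffs_def convergent_at_mult(1) convergent_at_power(1))

text \<open>Entry p of the k-th generator before multiplication by
  \<open>inverse \<Omega> ^ w\<close>; the leading 1 is \<open>G k 0\<close>, in position
  \<open>d - k\<close>.\<close>

definition H :: "nat \<Rightarrow> nat \<Rightarrow> 'c fps" where
  "H k p = (if p < d - k then 0 else G k (p - (d - k)))"

lemma G_convergent: "k < d \<Longrightarrow> i \<le> k \<Longrightarrow> G k i \<in> convergent_at \<theta>"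
  using solution_convergent[OF G] by simp

lemma H_convergent: "k < d \<Longrightarrow> p \<le> d \<Longrightarrow> H k p \<in> convergent_at \<theta>"
  by (auto simp: H_def intro!: G_convergent)

lemma G_0: "k < d \<Longrightarrow> G k 0 = 1"
  using G by (auto simp: solves_system_def)

lemma fps_value_Omega_times:
  assumes "f \<in> convergent_at \<theta>"
  shows "fps_value (inverse \<Omega> ^ m * f) \<theta> = \<pi> ^ m * fps_value f \<theta>"
  using assms
  by (simp add: convergent_at_mult convergent_at_power fps_value_inverse_Omega)

lemma M_iff:
  "m \<in> M \<longleftrightarrow> (\<exists>a. (\<forall>k<d. a k \<in> ring_A \<iota>) \<and>
     m = (\<lambda>p\<in>{1..d}. \<Sum>k<d. a k * (\<pi> ^ w * fps_value (H k p) \<theta>)))"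
proof -
  have "vector_value d \<theta> (generator q \<theta> \<rho> d n k (G k)) p = \<pi> ^ w * fps_value (H k p) \<theta>"
    if "k < d" "p \<in> {1..d}" for k p
    using that fps_value_Omega_times[OF H_convergent[of k p]]
    by (simp add: vector_value_def generator_def H_def)
  then have "(\<lambda>p\<in>{1..d}. \<Sum>k<d. a k * vector_value d \<theta> (generator q \<theta> \<rho> d n k (G k)) p)
     = (\<lambda>p\<in>{1..d}. \<Sum>k<d. a k * (\<pi> ^ w * fps_value (H k p) \<theta>))" for a
    by (intro restrict_ext sum.cong) auto
  then show ?thesis
    unfolding M_eq monodromy_module_def Let_def q_eq[symmetric] \<theta>_eq[symmetric] by auto
qed

lemma M_zero: "(\<lambda>p\<in>{1..d}. 0) \<in> M"
  unfolding M_iff by (rule exI[of _ "\<lambda>_. 0"]) (simp add: ring_A_0)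

lemma M_add:
  assumes "m1 \<in> M" "m2 \<in> M"
  shows "(\<lambda>p\<in>{1..d}. m1 p + m2 p) \<in> M"
proof -
  obtain a b where "\<forall>k<d. a k \<in> ring_A \<iota>" "\<forall>k<d. b k \<in> ring_A \<iota>"
    and "m1 = (\<lambda>p\<in>{1..d}. \<Sum>k<d. a k * (\<pi> ^ w * fps_value (H k p) \<theta>))"
    and "m2 = (\<lambda>p\<in>{1..d}. \<Sum>k<d. b k * (\<pi> ^ w * fps_value (H k p) \<theta>))"
    using assms unfolding M_iff by blast
  then show ?thesis unfolding M_iff
    by (intro exI[of _ "\<lambda>k. a k + b k"])
       (auto simp: ring_A_add distrib_right sum.distrib intro!: restrict_ext)
qed

lemma M_minus:
  assumes "m \<in> M"
  shows "(\<lambda>p\<in>{1..d}. - m p) \<in> M"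
proof -
  obtain a where "\<forall>k<d. a k \<in> ring_A \<iota>"
    and "m = (\<lambda>p\<in>{1..d}. \<Sum>k<d. a k * (\<pi> ^ w * fps_value (H k p) \<theta>))"
    using assms unfolding M_iff by blast
  then show ?thesis unfolding M_iff
    by (intro exI[of _ "\<lambda>k. - a k"])
       (auto simp: ring_A_minus sum_negf intro!: restrict_ext)
qed

lemma coset_subset:
  assumes "m \<in> M" "\<And>p. p \<in> {1..d} \<Longrightarrow> u p = v p + m p"
  shows "coset d M u \<subseteq> coset d M v"
proof
  fix y assume "y \<in> coset d M u"
  then obtain m' where m': "m' \<in> M" "y = (\<lambda>p\<in>{1..d}. u p + m' p)"
    by (auto simp: coset_def)
  then have "y = (\<lambda>p\<in>{1..d}. v p + (\<lambda>p\<in>{1..d}. m p + m' p) p)"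
    by (auto simp: assms(2) add.assoc)
  then show "y \<in> coset d M v"
    unfolding coset_def using M_add[OF assms(1) m'(1)] by blast
qed

lemma coset_eqI:
  assumes "m \<in> M" "\<And>p. p \<in> {1..d} \<Longrightarrow> u p = v p + m p"
  shows "coset d M u = coset d M v"
proof (rule antisym)
  show "coset d M u \<subseteq> coset d M v" using coset_subset assms by blast
  show "coset d M v \<subseteq> coset d M u"
    using M_minus[OF assms(1)] by (rule coset_subset) (auto simp: assms(2))
qed

text \<open>Position p receives nothing from the generators with \<open>k < d - p\<close>, and those
  with \<open>k > d - p\<close> have coefficient 0 by induction on p. What remains is
  \<open>a (d - p) * \<pi> ^ w\<close>, and an element of A smaller than 1 is 0.\<close>

lemma M_discrete:
  assumes m: "m \<in> M" and small: "\<And>p. p \<in> {1..d} \<Longrightarrow> absval (m p) < absval (\<pi> ^ w)"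
    and p: "p \<in> {1..d}"
  shows "m p = 0"
proof -
  obtain a where a: "\<And>k. k < d \<Longrightarrow> a k \<in> ring_A \<iota>"
    and m_eq: "m = (\<lambda>p\<in>{1..d}. \<Sum>k<d. a k * (\<pi> ^ w * fps_value (H k p) \<theta>))"
    using m unfolding M_iff by blast
  have a0: "a (d - p) = 0" if "p \<in> {1..d}" for p
    using that
  proof (induction p rule: less_induct)
    case (less p)
    have "a k * (\<pi> ^ w * fps_value (H k p) \<theta>) = 0" if k: "k \<in> {..<d} - {d - p}" for k
    proof (cases "k < d - p")
      case True
      then show ?thesis by (simp add: H_def)
    next
      case False
      then have "d - k < p" "d - k \<in> {1..d}" "d - (d - k) = k" using k less.prems by auto
      then show ?thesis using less.IH[of "d - k"] by simp
    qed
    then have "(\<Sum>k\<in>{..<d} - {d - p}. a k * (\<pi> ^ w * fps_value (H k p) \<theta>)) = 0"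
      by (intro sum.neutral) blast
    moreover have "m p = a (d - p) * (\<pi> ^ w * fps_value (H (d - p) p) \<theta>)
        + (\<Sum>k\<in>{..<d} - {d - p}. a k * (\<pi> ^ w * fps_value (H k p) \<theta>))"
      using less.prems by (simp add: m_eq sum.remove[of "{..<d}" "d - p"])
    moreover have "H (d - p) p = 1"
      using less.prems by (simp add: H_def G_0)
    ultimately have "absval (m p) = absval (a (d - p)) * absval (\<pi> ^ w)"
      by (simp add: absval_mult)
    moreover have "absval (\<pi> ^ w) > 0" using pi_tilde_neq_0 by simp
    ultimately have "absval (a (d - p)) < 1"
      using small[OF less.prems] by simp
    then show ?case using absval_ring_A_ge_1[OF a, of "d - p"] less.prems by fastforce
  qed
  have "a k = 0" if "k < d" for k
    using a0[of "d - k"] that by simp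
  then show ?thesis using p by (simp add: m_eq)
qed

text \<open>Two points of a polydisk differ in each coordinate by at most its radius, not twice
  that, so the bound from \<open>M_discrete\<close> can be used in full.\<close>

lemma inj_on_coset_polydisk:
  assumes "\<And>p. p \<in> {1..d} \<Longrightarrow> e p < absval (\<pi> ^ w)"
  shows "inj_on (coset d M) (\<Pi>\<^sub>E p\<in>{1..d}. cball (c p) (e p))"
proof (rule inj_onI)
  fix u v assume u: "u \<in> (\<Pi>\<^sub>E p\<in>{1..d}. cball (c p) (e p))" and v: "v \<in> (\<Pi>\<^sub>E p\<in>{1..d}. cball (c p) (e p))"
    and eq: "coset d M u = coset d M v"
  have "(\<lambda>p\<in>{1..d}. u p + (\<lambda>p\<in>{1..d}. 0) p) \<in> coset d M u"
    unfolding coset_def using M_zero by blast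
  then obtain m where m: "m \<in> M" "(\<lambda>p\<in>{1..d}. u p + (\<lambda>p\<in>{1..d}. 0) p) = (\<lambda>p\<in>{1..d}. v p + m p)"
    unfolding eq by (auto simp: coset_def)
  have uv: "u p = v p + m p" if "p \<in> {1..d}" for p
    using fun_cong[OF m(2), of p] that by simp
  have "absval (m p) < absval (\<pi> ^ w)" if p: "p \<in> {1..d}" for p
  proof -
    have "absval (u p - c p) \<le> e p" "absval (v p - c p) \<le> e p"
      using u v p by (auto simp: PiE_def Pi_def dist_absval absval_minus_commute)
    then have "absval ((u p - c p) - (v p - c p)) \<le> e p" by (rule absval_diff_le)
    then show ?thesis using assms[OF p] uv[OF p] by simp
  qed
  then have "m p = 0" if "p \<in> {1..d}" for p using M_discrete[OF m(1)] that by blast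
  then show "u = v" using uv u v by (intro PiE_ext[of u _ _ v]) auto
qed

section \<open>Differences of solutions as F_q[t]-combinations of the generators\<close>

definition fps_of_A :: "'f poly \<Rightarrow> 'c fps" where
  "fps_of_A p = Abs_fps (\<lambda>k. const_emb (coeff p k))"

lemma wp_fps_of_A_mult: "wp q (fps_of_A p * f) = fps_of_A p * wp q f"
proof -
  have "twist q (fps_of_A p) = fps_of_A p"
    by (simp add: fps_eq_iff fps_of_A_def q_eq finite_field_power_card_same flip: const_emb_power)
  then show ?thesis using twisted_mult[of 1 "fps_of_A p" f] by (simp add: wp_def algebra_simps)
qed

text \<open>Differences of solutions start with 0 instead of 1. The first equation then says that
  \<open>wp q (D 1)\<close> is 0, so that the last argument drops out and \<open>z\<close> can stand
  for every \<open>z(d := zd)\<close>.\<close>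

definition homogeneous_solution :: "(nat \<Rightarrow> 'c fps) \<Rightarrow> bool" where
  "homogeneous_solution D \<longleftrightarrow> D 0 = 0 \<and>
     (\<forall>i\<in>{1..d}. D i \<in> tate_algebra \<and> wp q (D i) = Ys z (d - i + 1) * twist q (D (i - 1)))"

lemma homogeneous_solution_H:
  assumes "k < d"
  shows "homogeneous_solution (H k)"
  unfolding homogeneous_solution_def
proof (intro conjI ballI)
  show "H k 0 = 0" using assms by (simp add: H_def)
  fix i assume i: "i \<in> {1..d}"
  show "H k i \<in> tate_algebra"
    using assms i by (intro convergent_at_theta_tate H_convergent) auto
  consider "i < d - k" | "i = d - k" | "i > d - k" by linarith
  then show "wp q (H k i) = Ys z (d - i + 1) * twist q (H k (i - 1))"
  proof cases
    case 1
    then show ?thesis using twisted_0[of 1] by (simp add: H_def wp_def)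
  next
    case 2
    then have "H k i = 1" "H k (i - 1) = 0" using assms by (auto simp: H_def G_0)
    then show ?thesis using twisted_0[of 1] twisted_1[of 1] by (simp add: wp_def)
  next
    case 3
    let ?j = "i - (d - k)"
    have j: "?j \<in> {1..k}" using 3 i assms by auto
    then have "wp q (G k ?j) = Ys z (k - ?j + 1) * twist q (G k (?j - 1))"
      using G[OF assms] unfolding solves_system_def by blast
    moreover have "k - ?j = d - i" using 3 i assms by auto
    moreover have "H k i = G k ?j" "H k (i - 1) = G k (?j - 1)"
      using 3 by (auto simp: H_def intro: arg_cong[of _ _ "G k"])
    ultimately show ?thesis by simp
  qed
qed

lemma homogeneous_solution_diff_mult:
  assumes D: "homogeneous_solution D" and E: "homogeneous_solution E"
  shows "homogeneous_solution (\<lambda>i. D i - fps_of_A p * E i)"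
  unfolding homogeneous_solution_def
proof (intro conjI ballI)
  show "D 0 - fps_of_A p * E 0 = 0" using D E by (simp add: homogeneous_solution_def)
  fix i assume i: "i \<in> {1..d}"
  have "fps_of_A p \<in> tate_algebra"
    unfolding fps_of_A_def by (intro convergent_at_theta_tate fps_polynomial_value)
  then show "D i - fps_of_A p * E i \<in> tate_algebra"
    using D E i unfolding homogeneous_solution_def tate_algebra_eq
    by (blast intro: convergent_at_diff(1) convergent_at_mult(1))
  have "twist q (fps_of_A p * E (i - 1)) = fps_of_A p * twist q (E (i - 1))"
    using wp_fps_of_A_mult[of p "E (i - 1)"] by (simp add: wp_def algebra_simps)
  moreover have "twist q (D (i - 1) - fps_of_A p * E (i - 1)) =
      twist q (D (i - 1)) - twist q (fps_of_A p * E (i - 1))"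
    using twisted_diff[of 1] by simp
  moreover have "wp q (D i) = Ys z (d - i + 1) * twist q (D (i - 1))"
    "wp q (E i) = Ys z (d - i + 1) * twist q (E (i - 1))"
    using D E i unfolding homogeneous_solution_def by blast+
  ultimately show "wp q (D i - fps_of_A p * E i) =
      Ys z (d - i + 1) * twist q (D (i - 1) - fps_of_A p * E (i - 1))"
    by (simp only: wp_diff wp_fps_of_A_mult) (simp add: algebra_simps)
qed

text \<open>If all entries before position \<open>d - j\<close> vanish, the entry there is killed by
  wp and so lies in F_q[t]. Subtracting that multiple of \<open>H j\<close>, whose first nonzero
  entry is a 1 in this position, clears it without touching the earlier zeros.\<close>

lemma homogeneous_solution_generated:
  assumes "homogeneous_solution D" "j \<le> d" "\<And>i. i \<le> d - j \<Longrightarrow> D i = 0"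
  shows "\<exists>c. \<forall>i\<in>{1..d}. D i = (\<Sum>k<j. fps_of_A (c k) * H k i)"
  using assms
proof (induction j arbitrary: D)
  case 0
  then show ?case by auto
next
  case (Suc j)
  let ?i = "d - j"
  have i: "?i \<in> {1..d}" "?i - 1 = d - Suc j" using Suc.prems by auto
  then have "D ?i \<in> tate_algebra" "wp q (D ?i) = Ys z (d - ?i + 1) * twist q (D (?i - 1))"
    using Suc.prems(1) unfolding homogeneous_solution_def by blast+
  moreover have "D (?i - 1) = 0" unfolding i(2) by (rule Suc.prems(3)) simp
  ultimately have "D ?i \<in> tate_algebra" "wp q (D ?i) = 0"
    using twisted_0[of 1] by simp_all
  then obtain p where p: "D ?i = fps_of_A p"
    unfolding fps_of_A_def by (rule fixed_tate_polynomial)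
  define D' where "D' = (\<lambda>i. D i - fps_of_A p * H j i)"
  have "D' i = 0" if "i \<le> d - j" for i
  proof (cases "i = d - j")
    case True
    then show ?thesis using Suc.prems(2) p by (simp add: D'_def H_def G_0)
  next
    case False
    then have "D i = 0" "H j i = 0" using that Suc.prems(3)[of i] by (auto simp: H_def)
    then show ?thesis by (simp add: D'_def)
  qed
  moreover have "homogeneous_solution D'"
    unfolding D'_def using Suc.prems by (intro homogeneous_solution_diff_mult homogeneous_solution_H) auto
  ultimately obtain c where c: "\<And>i. i \<in> {1..d} \<Longrightarrow> D' i = (\<Sum>k<j. fps_of_A (c k) * H k i)"
    using Suc.IH[of D'] Suc.prems(2) by (meson Suc_leD)
  show ?case
  proof (intro exI[of _ "c(j := p)"] ballI)
    fix i assume "i \<in> {1..d}"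
    then have "D i = (\<Sum>k<j. fps_of_A (c k) * H k i) + fps_of_A p * H j i"
      using c[of i] by (simp add: D'_def algebra_simps)
    then show "D i = (\<Sum>k<Suc j. fps_of_A ((c(j := p)) k) * H k i)" by simp
  qed
qed

lemma solution_values_congruent:
  assumes F: "solves_system q d (Ys (z(d := zd))) F" and F': "solves_system q d (Ys (z(d := zd))) F'"
  shows "\<exists>m\<in>M. \<forall>p\<in>{1..d}. \<pi> ^ w * fps_value (F' p) \<theta> = \<pi> ^ w * fps_value (F p) \<theta> + m p"
proof -
  define D where "D = (\<lambda>i. F' i - F i)"
  have conv: "F i \<in> convergent_at \<theta>" "F' i \<in> convergent_at \<theta>" if "i \<le> d" for i
    using solution_convergent[OF F _ that] solution_convergent[OF F' _ that] by simp_all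
  have D0: "D 0 = 0" using F F' by (simp add: D_def solves_system_def)
  have "homogeneous_solution D"
    unfolding homogeneous_solution_def
  proof (intro conjI ballI)
    show "D 0 = 0" by (rule D0)
    fix i assume i: "i \<in> {1..d}"
    show "D i \<in> tate_algebra"
      unfolding D_def using i by (intro convergent_at_theta_tate convergent_at_diff(1) conv) auto
    have "wp q (F i) = Ys (z(d := zd)) (d - i + 1) * twist q (F (i - 1))"
      "wp q (F' i) = Ys (z(d := zd)) (d - i + 1) * twist q (F' (i - 1))"
      using F F' i unfolding solves_system_def by blast+
    then have "wp q (D i) = Ys (z(d := zd)) (d - i + 1) * twist q (D (i - 1))"
      using twisted_diff[of 1 "F' (i - 1)" "F (i - 1)"] by (simp add: D_def wp_diff right_diff_distrib)
    also have "\<dots> = Ys z (d - i + 1) * twist q (D (i - 1))"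
    \<comment> \<open>Only the equation with i = 1 contains \<open>zd\<close>, and there the other
      factor is the twist of \<open>D 0 = 0\<close>.\<close>
    proof (cases "i = 1")
      case True
      then show ?thesis using D0 twisted_0[of 1] by simp
    next
      case False
      then have "d - i + 1 \<noteq> d" using i by auto
      then show ?thesis by (simp add: system_coeffs_def)
    qed
    finally show "wp q (D i) = Ys z (d - i + 1) * twist q (D (i - 1))" .
  qed
  then obtain c where c: "\<And>i. i \<in> {1..d} \<Longrightarrow> D i = (\<Sum>k<d. fps_of_A (c k) * H k i)"
    using homogeneous_solution_generated[of D d] D0 by auto
  define m where "m = (\<lambda>p\<in>{1..d}. \<Sum>k<d. A_value (c k) * (\<pi> ^ w * fps_value (H k p) \<theta>))"
  have "m \<in> M" unfolding M_iff m_def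
    by (intro exI[of _ "\<lambda>k. A_value (c k)"]) (simp add: ring_A_eq)
  moreover have "\<pi> ^ w * fps_value (F' p) \<theta> = \<pi> ^ w * fps_value (F p) \<theta> + m p" if p: "p \<in> {1..d}" for p
  proof -
    have "fps_value (fps_of_A (c k) * H k p) \<theta> = A_value (c k) * fps_value (H k p) \<theta>"
      "fps_of_A (c k) * H k p \<in> convergent_at \<theta>" if "k < d" for k
      using convergent_at_mult[OF fps_polynomial_value(1)[of "c k"] H_convergent[of k p]]
        fps_polynomial_value(2) p that by (auto simp: fps_of_A_def)
    then have "fps_value (D p) \<theta> = (\<Sum>k<d. A_value (c k) * fps_value (H k p) \<theta>)"
      using convergent_at_sum[of "{..<d}" "\<lambda>k. fps_of_A (c k) * H k p" \<theta>] c[OF p] by simp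
    moreover have "fps_value (D p) \<theta> = fps_value (F' p) \<theta> - fps_value (F p) \<theta>"
      unfolding D_def using p by (intro convergent_at_diff conv) auto
    ultimately have "fps_value (F' p) \<theta> = fps_value (F p) \<theta> + (\<Sum>k<d. A_value (c k) * fps_value (H k p) \<theta>)"
      by (simp add: algebra_simps)
    then show ?thesis
      using p by (simp add: m_def distrib_left sum_distrib_left mult_ac)
  qed
  ultimately show ?thesis by blast
qed

lemma Li_class_eq:
  assumes F: "solves_system q d (Ys (z(d := zd))) F"
    and v: "\<And>p. p \<in> {1..d} \<Longrightarrow> v p = \<pi> ^ w * fps_value (F p) \<theta>"
  shows "Li_class q \<theta> \<rho> d n (z(d := zd)) M = coset d M v"
proof -
  have "coset d M (vector_value d \<theta> u) = coset d M v"
    if "u \<in> Li_vectors q \<theta> \<rho> d n (z(d := zd))" for u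
  proof -
    obtain F' where F': "solves_system q d (Ys (z(d := zd))) F'"
      and u: "u = (\<lambda>p\<in>{1..d}. inverse \<Omega> ^ w * F' p)"
      using \<open>u \<in> _\<close> by (auto simp: Li_vectors_def)
    obtain m where m: "m \<in> M" "\<And>p. p \<in> {1..d} \<Longrightarrow> \<pi> ^ w * fps_value (F' p) \<theta> = \<pi> ^ w * fps_value (F p) \<theta> + m p"
      using solution_values_congruent[OF F F'] by blast
    show ?thesis
    proof (rule coset_eqI[OF m(1)])
      fix p assume p: "p \<in> {1..d}"
      have "vector_value d \<theta> u p = \<pi> ^ w * fps_value (F' p) \<theta>"
        using p fps_value_Omega_times[OF solution_convergent[OF F', of p]] by (simp add: vector_value_def u)
      then show "vector_value d \<theta> u p = v p + m p" using v m(2) p by simp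
    qed
  qed
  \<comment> \<open>\<open>Li_class\<close> is a union of cosets, all equal by now; the given
    solution shows that the union is not empty.\<close>
  moreover have "(\<lambda>p\<in>{1..d}. inverse \<Omega> ^ w * F p) \<in> Li_vectors q \<theta> \<rho> d n (z(d := zd))"
    using F by (auto simp: Li_vectors_def)
  ultimately show ?thesis unfolding Li_class_def by blast
qed

end

section \<open>Sums over increasing tuples\<close>

lemma increasing_tuples_0: "increasing_tuples 0 = {\<lambda>_. undefined}"
  by (simp add: increasing_tuples_def strict_mono_on_def)

lemma increasing_tuplesD:
  assumes "i \<in> increasing_tuples p" "j \<in> {1..p}" "k \<in> {1..p}" "j < k"
  shows "i j < i k"
  using assms by (auto simp: increasing_tuples_def strict_mono_on_def)

lemma increasing_tuples_le_last:
  assumes "i \<in> increasing_tuples p" "j \<in> {1..p}"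
  shows "i j \<le> i p"
  using increasing_tuplesD[OF assms, of p] assms(2) by (cases "j = p") auto

lemma finite_increasing_tuples_bounded: "finite {i \<in> increasing_tuples p. i p \<le> N}"
proof (rule finite_subset)
  show "{i \<in> increasing_tuples p. i p \<le> N} \<subseteq> {1..p} \<rightarrow>\<^sub>E {..N}"
  proof
    fix i assume i: "i \<in> {i \<in> increasing_tuples p. i p \<le> N}"
    then have "i j \<le> N" if "j \<in> {1..p}" for j
      using increasing_tuples_le_last[of i p j] that by auto
    then show "i \<in> {1..p} \<rightarrow>\<^sub>E {..N}"
      using i by (auto simp: increasing_tuples_def PiE_def Pi_def)
  qed
qed (simp add: finite_PiE)

text \<open>Twisting a term raises all its indices by one. \<open>cons_tuple\<close> also puts a 0
  in front, for a new first factor that is left untwisted.\<close>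

definition shift_tuple :: "nat \<Rightarrow> (nat \<Rightarrow> nat) \<Rightarrow> nat \<Rightarrow> nat" where
  "shift_tuple p i = (\<lambda>j\<in>{1..p}. Suc (i j))"

definition cons_tuple :: "nat \<Rightarrow> (nat \<Rightarrow> nat) \<Rightarrow> nat \<Rightarrow> nat" where
  "cons_tuple p i = (\<lambda>j\<in>{1..Suc p}. if j = 1 then 0 else Suc (i (j - 1)))"

lemma inj_on_shift_tuple: "inj_on (shift_tuple p) (increasing_tuples p)"
proof (rule inj_onI)
  fix i i' assume i: "i \<in> increasing_tuples p" "i' \<in> increasing_tuples p" and e: "shift_tuple p i = shift_tuple p i'"
  have "i j = i' j" if "j \<in> {1..p}" for j
    using fun_cong[OF e, of j] that by (simp add: shift_tuple_def)
  then show "i = i'"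
    using i by (intro PiE_ext[of i "{1..p}" "\<lambda>_. UNIV" i']) (simp_all add: increasing_tuples_def)
qed

lemma inj_on_cons_tuple: "inj_on (cons_tuple p) (increasing_tuples p)"
proof (rule inj_onI)
  fix i i' assume i: "i \<in> increasing_tuples p" "i' \<in> increasing_tuples p" and e: "cons_tuple p i = cons_tuple p i'"
  have "i j = i' j" if "j \<in> {1..p}" for j
    using fun_cong[OF e, of "Suc j"] that by (simp add: cons_tuple_def)
  then show "i = i'"
    using i by (intro PiE_ext[of i "{1..p}" "\<lambda>_. UNIV" i']) (simp_all add: increasing_tuples_def)
qed

text \<open>Either the first index is positive, and then all are, or it is 0 and the remaining ones
  are positive.\<close>

lemma increasing_tuples_Suc:
  "increasing_tuples (Suc p) = shift_tuple (Suc p) ` increasing_tuples (Suc p) \<union> cons_tuple p ` increasing_tuples p"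
    (is "?I = ?S \<union> ?C")
proof
  show "?S \<union> ?C \<subseteq> ?I"
  proof (intro Un_least image_subsetI)
    fix i assume "i \<in> increasing_tuples (Suc p)"
    then show "shift_tuple (Suc p) i \<in> ?I"
      by (auto simp: increasing_tuples_def shift_tuple_def strict_mono_on_def)
  next
    fix i assume i: "i \<in> increasing_tuples p"
    have "cons_tuple p i j < cons_tuple p i k" if "j \<in> {1..Suc p}" "k \<in> {1..Suc p}" "j < k" for j k
      using that increasing_tuplesD[OF i, of "j - 1" "k - 1"] by (auto simp: cons_tuple_def)
    then show "cons_tuple p i \<in> ?I"
      by (auto simp: increasing_tuples_def cons_tuple_def strict_mono_on_def)
  qed
  show "?I \<subseteq> ?S \<union> ?C"
  proof
    fix i assume i: "i \<in> ?I"
    have ext: "i \<in> extensional {1..Suc p}" using i by (auto simp: increasing_tuples_def PiE_def)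
    show "i \<in> ?S \<union> ?C"
    proof (cases "i 1 = 0")
      case True
      define i' where "i' = (\<lambda>j\<in>{1..p}. i (Suc j) - 1)"
      have pos: "0 < i (Suc j)" if "j \<in> {1..p}" for j
        using increasing_tuplesD[OF i, of 1 "Suc j"] that by auto
      have "i' j < i' k" if "j \<in> {1..p}" "k \<in> {1..p}" "j < k" for j k
        using increasing_tuplesD[OF i, of "Suc j" "Suc k"] that pos[of j] by (auto simp: i'_def)
      then have "i' \<in> increasing_tuples p"
        by (auto simp: increasing_tuples_def i'_def strict_mono_on_def)
      moreover have "i = cons_tuple p i'"
      proof (rule extensionalityI[OF ext])
        show "cons_tuple p i' \<in> extensional {1..Suc p}" by (simp add: cons_tuple_def)
        fix j assume j: "j \<in> {1..Suc p}"
        show "i j = cons_tuple p i' j"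
        proof (cases "j = 1")
          case False
          then have "j - 1 \<in> {1..p}" "Suc (j - 1) = j" using j by auto
          then show ?thesis using False j pos[of "j - 1"] by (auto simp: cons_tuple_def i'_def)
        qed (use True j in \<open>simp add: cons_tuple_def\<close>)
      qed
      ultimately show ?thesis by blast
    next
      case False
      define i' where "i' = (\<lambda>j\<in>{1..Suc p}. i j - 1)"
      have pos: "0 < i j" if "j \<in> {1..Suc p}" for j
        using increasing_tuplesD[OF i, of 1 j] that False by (cases "j = 1") auto
      have "i' j < i' k" if "j \<in> {1..Suc p}" "k \<in> {1..Suc p}" "j < k" for j k
        using increasing_tuplesD[OF i, of j k] that pos[of j] by (auto simp: i'_def)
      then have "i' \<in> ?I"
        by (auto simp: increasing_tuples_def i'_def strict_mono_on_def)
      moreover have "i = shift_tuple (Suc p) i'"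
      proof (rule extensionalityI[OF ext])
        show "shift_tuple (Suc p) i' \<in> extensional {1..Suc p}" by (simp add: shift_tuple_def)
        fix j assume "j \<in> {1..Suc p}"
        then show "i j = shift_tuple (Suc p) i' j" using pos[of j] by (simp add: shift_tuple_def i'_def)
      qed
      ultimately show ?thesis by blast
    qed
  qed
qed

lemma shift_cons_disjoint:
  "shift_tuple (Suc p) ` increasing_tuples (Suc p) \<inter> cons_tuple p ` increasing_tuples p = {}"
proof -
  have "shift_tuple (Suc p) i 1 \<noteq> cons_tuple p i' 1" for i i'
    by (simp add: shift_tuple_def cons_tuple_def)
  then show ?thesis by (metis (no_types, lifting) disjoint_iff imageE)
qed

lemma has_sum_finite_sum:
  fixes f :: "'l \<Rightarrow> 'i \<Rightarrow> 'c::complete_nonarch_field"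
  assumes "\<And>l. l \<in> L \<Longrightarrow> (f l has_sum s l) A"
  shows "((\<lambda>i. \<Sum>l\<in>L. f l i) has_sum (\<Sum>l\<in>L. s l)) A"
  using assms by (induction L rule: infinite_finite_induct) (auto intro!: has_sum_add)

text \<open>\<open>b j\<close> stands for a bound on the j-th factor. For nonnegative
  \<open>b\<close> this is the limit in \<open>convergence_region\<close>, in the form of
  \<open>null_family\<close>.\<close>

definition vanishing :: "nat \<Rightarrow> nat \<Rightarrow> (nat \<Rightarrow> real) \<Rightarrow> bool" where
  "vanishing q p b \<longleftrightarrow> (\<forall>e>0. finite {i \<in> increasing_tuples p. (\<Prod>j=1..p. b j ^ q ^ i j) \<ge> e})"

lemma vanishing_bounded:
  assumes "vanishing q p b"
  obtains K where "K > 0" "\<And>i. i \<in> increasing_tuples p \<Longrightarrow> (\<Prod>j=1..p. b j ^ q ^ i j) \<le> K"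
proof -
  let ?f = "\<lambda>i. \<Prod>j=1..p. b j ^ q ^ i j"
  have "finite {i \<in> increasing_tuples p. ?f i \<ge> 1}" using assms by (auto simp: vanishing_def)
  then have fin: "finite (?f ` {i \<in> increasing_tuples p. ?f i \<ge> 1})" by simp
  define K where "K = Max (?f ` {i \<in> increasing_tuples p. ?f i \<ge> 1})"
  have K: "?f i \<le> K" if "i \<in> increasing_tuples p" "?f i \<ge> 1" for i
    unfolding K_def using fin that by (intro Max_ge) auto
  show thesis
  proof (rule that[of "max 1 K"])
    show "?f i \<le> max 1 K" if "i \<in> increasing_tuples p" for i
      using K[OF that] by linarith
  qed simp
qed

lemma sum_powers_le:
  assumes "q \<ge> (2::nat)"
  shows "(\<Sum>k<N. q ^ k) \<le> q ^ N"
proof (induction N)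
  case (Suc N)
  then have "(\<Sum>k<Suc N. q ^ k) \<le> 2 * q ^ N" by simp
  also have "\<dots> \<le> q ^ Suc N" using assms by simp
  finally show ?case .
qed simp

text \<open>The indices before the last are distinct and smaller than \<open>i p\<close>, so their
  powers of q add up to at most \<open>q ^ i p\<close>. All earlier factors together therefore cost
  no more than one factor \<open>B ^ q ^ i p\<close>, which a small \<open>b p\<close> can
  absorb.\<close>

lemma tuple_product_le:
  fixes b :: "nat \<Rightarrow> real" and B :: real
  assumes i: "i \<in> increasing_tuples p" and p: "p \<ge> 1" and q: "q \<ge> 2"
    and b: "\<And>j. j \<in> {1..<p} \<Longrightarrow> b j \<le> B" "\<And>j. b j \<ge> 0" and B: "B \<ge> 1"
  shows "(\<Prod>j=1..p. b j ^ q ^ i j) \<le> (B * b p) ^ q ^ i p"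
proof -
  have inj: "inj_on i {1..<p}"
  proof (rule strict_mono_on_imp_inj_on)
    show "strict_mono_on {1..<p} i"
      by (rule strict_mono_onI) (use increasing_tuplesD[OF i] in auto)
  qed
  have "i ` {1..<p} \<subseteq> {..<i p}"
    using increasing_tuplesD[OF i, of _ p] by auto
  then have "(\<Sum>j\<in>{1..<p}. q ^ i j) \<le> (\<Sum>k<i p. q ^ k)"
    by (subst sum.reindex[OF inj, of "\<lambda>k. q ^ k", unfolded o_def, symmetric]) (auto intro: sum_mono2)
  also have "\<dots> \<le> q ^ i p" using q by (rule sum_powers_le)
  finally have exp: "(\<Sum>j\<in>{1..<p}. q ^ i j) \<le> q ^ i p" .
  have "(\<Prod>j\<in>{1..<p}. b j ^ q ^ i j) \<le> (\<Prod>j\<in>{1..<p}. B ^ q ^ i j)"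
    using b by (intro prod_mono) (auto intro: power_mono)
  also have "\<dots> = B ^ (\<Sum>j\<in>{1..<p}. q ^ i j)" by (simp add: power_sum)
  also have "\<dots> \<le> B ^ q ^ i p" using exp B by (intro power_increasing)
  finally have "(\<Prod>j\<in>{1..<p}. b j ^ q ^ i j) \<le> B ^ q ^ i p" .
  moreover have "{1..p} = insert p {1..<p}" using p by auto
  ultimately have "(\<Prod>j=1..p. b j ^ q ^ i j) \<le> b p ^ q ^ i p * B ^ q ^ i p"
    using b by (simp add: mult_left_mono)
  then show ?thesis by (simp add: power_mult_distrib mult.commute)
qed

lemma vanishing_small_last:
  fixes b :: "nat \<Rightarrow> real" and B :: real
  assumes p: "p \<ge> 1" and q: "q \<ge> 2"
    and b: "\<And>j. j \<in> {1..<p} \<Longrightarrow> b j \<le> B" "\<And>j. b j \<ge> 0" and B: "B \<ge> 1" and small: "B * b p < 1"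
  shows "vanishing q p b"
  unfolding vanishing_def
proof (intro allI impI)
  fix e :: real assume e: "e > 0"
  have c: "B * b p \<ge> 0" using b(2) B by simp
  then have "(\<lambda>l. (B * b p) ^ l) \<longlonglongrightarrow> 0" using small by (intro LIMSEQ_realpow_zero) auto
  then have "\<forall>\<^sub>F l in sequentially. (B * b p) ^ l < e" using e by (rule order_tendstoD)
  then obtain N where N: "\<And>l. l \<ge> N \<Longrightarrow> (B * b p) ^ l < e" by (auto simp: eventually_sequentially)
  have "{i \<in> increasing_tuples p. (\<Prod>j=1..p. b j ^ q ^ i j) \<ge> e} \<subseteq> {i \<in> increasing_tuples p. i p \<le> N}"
  proof safe
    fix i assume i: "i \<in> increasing_tuples p" and le: "e \<le> (\<Prod>j=1..p. b j ^ q ^ i j)"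
    show "i p \<le> N"
    proof (rule ccontr)
      assume "\<not> i p \<le> N"
      moreover have "i p \<le> q ^ i p"
        using less_exp[of "i p"] power_mono[of 2 q "i p"] q by linarith
      ultimately have "(B * b p) ^ q ^ i p < e" by (intro N) linarith
      then show False using tuple_product_le[of i p q b B] i p q b B le by force
    qed
  qed
  then show "finite {i \<in> increasing_tuples p. (\<Prod>j=1..p. b j ^ q ^ i j) \<ge> e}"
    using finite_increasing_tuples_bounded finite_subset by blast
qed

section \<open>Series over increasing tuples of twisted factors\<close>

context carlitz_setting
begin

definition tuple_term :: "nat \<Rightarrow> (nat \<Rightarrow> 'c fps) \<Rightarrow> (nat \<Rightarrow> nat) \<Rightarrow> 'c fps" where
  "tuple_term p y i = (\<Prod>j=1..p. twisted (i j) (y j))"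

text \<open>Summed in each coefficient with the metric of \<open>'c\<close>, because in general the
  terms do not tend to 0 in the X-adic topology.\<close>

definition tuple_series :: "nat \<Rightarrow> (nat \<Rightarrow> 'c fps) \<Rightarrow> 'c fps" where
  "tuple_series p y = Abs_fps (\<lambda>k. \<Sum>\<^sub>\<infinity>i\<in>increasing_tuples p. fps_nth (tuple_term p y i) k)"

lemma tuple_term_bound:
  assumes "\<And>j. geom_bounded decay (b j) (y j)"
  shows "geom_bounded decay (\<Prod>j=1..p. b j ^ q ^ i j) (tuple_term p y i)"
  unfolding tuple_term_def using assms decay_bounds
  by (intro geom_bounded_prod geom_bounded_twist) auto

lemma tuple_family_null:
  assumes b: "\<And>j. geom_bounded decay (b j) (y j)" and van: "vanishing q p b"
  shows "null_family (\<lambda>i. fps_nth (tuple_term p y i) k) (increasing_tuples p)"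
  unfolding null_family_def
proof (intro allI impI)
  fix e :: real assume "e > 0"
  then have "finite {i \<in> increasing_tuples p. (\<Prod>j=1..p. b j ^ q ^ i j) \<ge> e}"
    using van by (auto simp: vanishing_def)
  moreover have "absval (fps_nth (tuple_term p y i) k) \<le> (\<Prod>j=1..p. b j ^ q ^ i j)" for i
  proof -
    have g: "geom_bounded decay (\<Prod>j=1..p. b j ^ q ^ i j) (tuple_term p y i)" using b by (rule tuple_term_bound)
    then have "absval (fps_nth (tuple_term p y i) k) \<le> (\<Prod>j=1..p. b j ^ q ^ i j) * decay ^ k"
      by (simp add: geom_bounded_def)
    also have "\<dots> \<le> (\<Prod>j=1..p. b j ^ q ^ i j)"
      using geom_bounded_nonneg[OF g] decay_bounds by (intro mult_left_le power_le_one) auto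
    finally show ?thesis .
  qed
  ultimately show "finite {i \<in> increasing_tuples p. absval (fps_nth (tuple_term p y i) k) \<ge> e}"
    by (elim rev_finite_subset) (auto intro: order_trans)
qed

lemma tuple_series_has_sum:
  assumes "\<And>j. geom_bounded decay (b j) (y j)" "vanishing q p b"
  shows "((\<lambda>i. fps_nth (tuple_term p y i) k) has_sum fps_nth (tuple_series p y) k) (increasing_tuples p)"
  using null_family_summable[OF tuple_family_null[OF assms]] by (simp add: tuple_series_def)

lemma tuple_series_bound:
  assumes b: "\<And>j. geom_bounded decay (b j) (y j)" and van: "vanishing q p b"
    and K: "\<And>i. i \<in> increasing_tuples p \<Longrightarrow> (\<Prod>j=1..p. b j ^ q ^ i j) \<le> K" "K \<ge> 0"
  shows "geom_bounded decay K (tuple_series p y)"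
  unfolding geom_bounded_def
proof
  fix k
  show "absval (fps_nth (tuple_series p y) k) \<le> K * decay ^ k"
  proof (rule has_sum_absval_le[OF tuple_series_has_sum[OF b van]])
    fix i assume i: "i \<in> increasing_tuples p"
    have "absval (fps_nth (tuple_term p y i) k) \<le> (\<Prod>j=1..p. b j ^ q ^ i j) * decay ^ k"
      using tuple_term_bound[where p = p and i = i, OF b] by (simp add: geom_bounded_def)
    also have "\<dots> \<le> K * decay ^ k" using K(1)[OF i] decay_bounds by (intro mult_right_mono) auto
    finally show "absval (fps_nth (tuple_term p y i) k) \<le> K * decay ^ k" .
  qed (use K decay_bounds in auto)
qed

lemma tuple_series_convergent:
  assumes b: "\<And>j. geom_bounded decay (b j) (y j)" and van: "vanishing q p b"
  shows "tuple_series p y \<in> convergent_at \<theta>"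
proof -
  obtain K where K: "K > 0" "\<And>i. i \<in> increasing_tuples p \<Longrightarrow> (\<Prod>j=1..p. b j ^ q ^ i j) \<le> K"
    using vanishing_bounded[OF van] by blast
  have "geom_bounded decay K (tuple_series p y)"
    using tuple_series_bound[OF b van K(2)] K(1) by simp
  then show ?thesis using decay_bounds by (intro geom_bounded_convergent_at)
qed

lemma tuple_series_0: "tuple_series 0 y = 1"
  by (simp add: tuple_series_def increasing_tuples_0 tuple_term_def fps_eq_iff)

lemma tuple_term_shift: "tuple_term p y (shift_tuple p i) = twist q (tuple_term p y i)"
proof -
  have "twist q (tuple_term p y i) = twisted 1 (tuple_term p y i)" by simp
  also have "\<dots> = (\<Prod>j=1..p. twisted (1 + i j) (y j))"
    unfolding tuple_term_def twisted_prod twisted_twisted ..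
  also have "\<dots> = tuple_term p y (shift_tuple p i)"
    unfolding tuple_term_def by (intro prod.cong) (auto simp: shift_tuple_def)
  finally show ?thesis ..
qed

lemma tuple_term_cons:
  "tuple_term (Suc p) y (cons_tuple p i) = y 1 * twist q (tuple_term p (\<lambda>j. y (Suc j)) i)"
proof -
  have "twist q (tuple_term p (\<lambda>j. y (Suc j)) i) = twisted 1 (tuple_term p (\<lambda>j. y (Suc j)) i)" by simp
  also have "\<dots> = (\<Prod>j=1..p. twisted (1 + i j) (y (Suc j)))"
    unfolding tuple_term_def twisted_prod twisted_twisted ..
  also have "\<dots> = (\<Prod>j=1..p. twisted (cons_tuple p i (Suc j)) (y (Suc j)))"
    by (intro prod.cong) (auto simp: cons_tuple_def)
  finally have "y 1 * twist q (tuple_term p (\<lambda>j. y (Suc j)) i)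
     = twisted (cons_tuple p i 1) (y 1) * (\<Prod>j=1..p. twisted (cons_tuple p i (Suc j)) (y (Suc j)))"
    by (simp add: cons_tuple_def)
  also have "\<dots> = (\<Prod>j=1..Suc p. twisted (cons_tuple p i j) (y j))"
    by (simp only: One_nat_def prod.atLeast_Suc_atMost_Suc_shift prod.atLeast_Suc_atMost[OF le0] o_def)
  finally show ?thesis by (simp add: tuple_term_def)
qed

text \<open>Splitting the tuples by whether they start with 0 gives the difference equation.\<close>

lemma wp_tuple_series:
  assumes b: "\<And>j. geom_bounded decay (b j) (y j)"
    and van: "vanishing q (Suc p) b" "vanishing q p (\<lambda>j. b (Suc j))"
  shows "wp q (tuple_series (Suc p) y) = y 1 * twist q (tuple_series p (\<lambda>j. y (Suc j)))"
proof (rule fps_ext)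
  fix k
  let ?E = "tuple_series (Suc p) y" and ?E' = "tuple_series p (\<lambda>j. y (Suc j))"
  let ?t = "\<lambda>i. fps_nth (tuple_term (Suc p) y i) k"
  \<comment> \<open>Applying the Frobenius to the whole sum yields the terms of the shifted tuples;
    the exponent is written \<open>q ^ 1\<close> to match \<open>frob_has_sum\<close>.\<close>
  have "((\<lambda>i. ?t i ^ q ^ 1) has_sum (fps_nth ?E k ^ q ^ 1)) (increasing_tuples (Suc p))"
    by (intro frob_has_sum tuple_series_has_sum[OF b van(1)])
  then have "((?t \<circ> shift_tuple (Suc p)) has_sum (fps_nth ?E k ^ q)) (increasing_tuples (Suc p))"
    by (simp add: o_def tuple_term_shift)
  then have 1: "(?t has_sum (fps_nth ?E k ^ q)) (shift_tuple (Suc p) ` increasing_tuples (Suc p))"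
    by (simp add: has_sum_reindex[OF inj_on_shift_tuple])
  have "((\<lambda>i. fps_nth (tuple_term p (\<lambda>j. y (Suc j)) i) l ^ q ^ 1) has_sum (fps_nth ?E' l ^ q ^ 1)) (increasing_tuples p)" for l
    by (intro frob_has_sum tuple_series_has_sum[OF _ van(2)] b)
  then have "((\<lambda>i. \<Sum>l=0..k. fps_nth (y 1) l * fps_nth (tuple_term p (\<lambda>j. y (Suc j)) i) (k - l) ^ q ^ 1) has_sum
      (\<Sum>l=0..k. fps_nth (y 1) l * fps_nth ?E' (k - l) ^ q ^ 1)) (increasing_tuples p)"
    by (intro has_sum_finite_sum has_sum_mult_left)
  then have "((?t \<circ> cons_tuple p) has_sum fps_nth (y 1 * twist q ?E') k) (increasing_tuples p)"
    by (simp add: o_def tuple_term_cons fps_mult_nth)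
  then have 2: "(?t has_sum fps_nth (y 1 * twist q ?E') k) (cons_tuple p ` increasing_tuples p)"
    by (simp add: has_sum_reindex[OF inj_on_cons_tuple])
  have "(?t has_sum (fps_nth ?E k ^ q + fps_nth (y 1 * twist q ?E') k)) (increasing_tuples (Suc p))"
    by (subst increasing_tuples_Suc) (rule has_sum_Un_disjoint[OF 1 2 shift_cons_disjoint])
  then have "fps_nth ?E k = fps_nth ?E k ^ q + fps_nth (y 1 * twist q ?E') k"
    using has_sum_unique[OF tuple_series_has_sum[OF b van(1)]] by blast
  then show "fps_nth (wp q ?E) k = fps_nth (y 1 * twist q ?E') k"
    by (simp add: wp_def algebra_simps)
qed

text \<open>Exchanges the sum over tuples with the sum over powers of t. The double family is null:
  its entries are at most a product that vanishes along the tuples times \<open>t ^ k\<close> with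
  \<open>t = decay * absval \<theta> < 1\<close>.\<close>

lemma tuple_series_value:
  assumes b: "\<And>j. geom_bounded decay (b j) (y j)" and van: "vanishing q p b"
  shows "((\<lambda>i. fps_value (tuple_term p y i) \<theta>) has_sum fps_value (tuple_series p y) \<theta>) (increasing_tuples p)"
proof -
  define t where "t = decay * absval \<theta>"
  have t: "0 \<le> t" "t < 1" using decay_bounds by (simp_all add: t_def)
  let ?I = "increasing_tuples p" and ?B = "\<lambda>i. \<Prod>j=1..p. b j ^ q ^ i j"
  let ?c = "\<lambda>(i, k). fps_nth (tuple_term p y i) k * \<theta> ^ k"
  have bound: "absval (?c (i, k)) \<le> ?B i * t ^ k" for i k
  proof -
    have "absval (fps_nth (tuple_term p y i) k) \<le> ?B i * decay ^ k"
      using tuple_term_bound[where p = p and i = i, OF b] by (simp add: geom_bounded_def)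
    from mult_right_mono[OF this, of "absval \<theta> ^ k"] show ?thesis
      by (simp add: t_def absval_mult absval_power power_mult_distrib mult.assoc)
  qed
  obtain K where K: "K > 0" "\<And>i. i \<in> ?I \<Longrightarrow> ?B i \<le> K"
    using vanishing_bounded[OF van] by blast
  have B0: "?B i \<ge> 0" for i
    using geom_bounded_nonneg[OF b] by (intro prod_nonneg) simp
  have "null_family ?c (?I \<times> UNIV)"
    unfolding null_family_def
  proof (intro allI impI)
    fix e :: real assume e: "e > 0"
    have "(\<lambda>k. K * t ^ k) \<longlonglongrightarrow> 0"
      using t by (intro tendsto_mult_right_zero LIMSEQ_realpow_zero) auto
    then have "\<forall>\<^sub>F k in sequentially. K * t ^ k < e" using e by (rule order_tendstoD)
    then obtain N where N: "\<And>k. k \<ge> N \<Longrightarrow> K * t ^ k < e" by (auto simp: eventually_sequentially)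
    have "finite ({i \<in> ?I. ?B i \<ge> e} \<times> {..<N})"
      using van e by (auto simp: vanishing_def)
    moreover have "{ik \<in> ?I \<times> UNIV. absval (?c ik) \<ge> e} \<subseteq> {i \<in> ?I. ?B i \<ge> e} \<times> {..<N}"
    proof
      fix ik assume "ik \<in> {ik \<in> ?I \<times> UNIV. absval (?c ik) \<ge> e}"
      then obtain i k where ik: "ik = (i, k)" "i \<in> ?I" and le: "e \<le> absval (?c (i, k))" by auto
      have le': "e \<le> ?B i * t ^ k" using le bound[of i k] by linarith
      also have "\<dots> \<le> ?B i" using B0 t by (intro mult_left_le power_le_one) auto
      finally have "e \<le> ?B i" .
      moreover have "?B i * t ^ k \<le> K * t ^ k" using K(2)[OF ik(2)] t by (intro mult_right_mono) auto
      then have "k < N" using le' N[of k] by (cases "k < N") auto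
      ultimately show "ik \<in> {i \<in> ?I. ?B i \<ge> e} \<times> {..<N}" using ik by simp
    qed
    ultimately show "finite {ik \<in> ?I \<times> UNIV. absval (?c ik) \<ge> e}" by (rule rev_finite_subset)
  qed
  then obtain l where l: "(?c has_sum l) (?I \<times> UNIV)"
    using null_family_summable summable_on_def by blast
  have "((\<lambda>k. fps_nth (tuple_term p y i) k * \<theta> ^ k) has_sum fps_value (tuple_term p y i) \<theta>) UNIV" for i
    using tuple_term_bound[where p = p and i = i, OF b] decay_bounds
    by (intro fps_value_has_sum geom_bounded_convergent_at) auto
  then have "((\<lambda>i. fps_value (tuple_term p y i) \<theta>) has_sum l) ?I"
    using has_sum_SigmaD[OF l] by simp
  moreover have "((\<lambda>(k, i). fps_nth (tuple_term p y i) k * \<theta> ^ k) has_sum l) (UNIV \<times> ?I)"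
    using l by (subst has_sum_reindex_bij_witness[where T = "?I \<times> UNIV" and s' = l
          and i = "\<lambda>(i, k). (k, i)" and j = "\<lambda>(k, i). (i, k)" and h = ?c]) auto
  then have "((\<lambda>k. fps_nth (tuple_series p y) k * \<theta> ^ k) has_sum l) UNIV"
    using has_sum_mult_left[OF tuple_series_has_sum[OF b van]]
    by (elim has_sum_SigmaD) (simp add: mult.commute)
  then have "fps_value (tuple_series p y) \<theta> = l" by (rule has_sum_imp_fps_value)
  ultimately show ?thesis by simp
qed

section \<open>The factors Y_j and the polylogarithm series\<close>

definition Y_coeff :: "(nat \<Rightarrow> nat) \<Rightarrow> (nat \<Rightarrow> 'c) \<Rightarrow> nat \<Rightarrow> 'c fps" where
  "Y_coeff m x j = \<Omega> ^ m j * fps_const (x j)"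

definition Y_bound :: "(nat \<Rightarrow> nat) \<Rightarrow> (nat \<Rightarrow> 'c) \<Rightarrow> nat \<Rightarrow> real" where
  "Y_bound m x j = absval (x j) * \<omega> ^ m j"

lemma geom_bounded_Y: "geom_bounded decay (Y_bound m x j) (Y_coeff m x j)"
  using geom_bounded_mult[OF geom_bounded_power[OF geom_bounded_Omega] geom_bounded_const] decay_bounds
  by (simp add: Y_coeff_def Y_bound_def mult.commute)

lemma Y_bound_nonneg: "Y_bound m x j \<ge> 0"
  using geom_bounded_nonneg[OF geom_bounded_Y] .

text \<open>Since \<open>\<omega>\<close> is \<open>q^(-q/(q-1))\<close>, the product of the Gauss
  norm bounds is literally the product in the definition of the region.\<close>

lemma vanishing_Y_bound_iff:
  "vanishing q p (Y_bound m x) \<longleftrightarrow> x \<in> convergence_region q p m"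
proof -
  have \<omega>: "\<omega> ^ k = real q powr (- (real q * real k / (real q - 1)))" for k
  proof -
    have "\<omega> ^ k = real q powr (- (real q / (real q - 1)) * real k)"
      using q_gt_1 by (simp add: omega_eq_powr powr_powr flip: powr_realpow)
    then show ?thesis by (simp add: mult.commute)
  qed
  have "(\<Prod>j=1..p. Y_bound m x j ^ q ^ i j) \<ge> 0" for i
    by (intro prod_nonneg) (auto simp: Y_bound_nonneg)
  then have "(\<forall>e>0. finite {i \<in> increasing_tuples p. e \<le> (\<Prod>j=1..p. Y_bound m x j ^ q ^ i j)}) \<longleftrightarrow>
      ((\<lambda>i. \<Prod>j=1..p. Y_bound m x j ^ q ^ i j) \<longlongrightarrow> 0) (inf cofinite (principal (increasing_tuples p)))"
    by (simp add: tendsto_iff eventually_inf_principal eventually_cofinite dist_norm not_less)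
  then show ?thesis
    by (simp add: vanishing_def convergence_region_def Y_bound_def \<omega>)
qed

definition Li_term :: "nat \<Rightarrow> (nat \<Rightarrow> nat) \<Rightarrow> (nat \<Rightarrow> 'c) \<Rightarrow> (nat \<Rightarrow> nat) \<Rightarrow> 'c" where
  "Li_term p m x i = (\<Prod>j=1..p. x j ^ (q ^ i j) / carlitz_L q \<theta> (i j) ^ m j)"

lemma fps_value_tuple_term:
  "fps_value (tuple_term p (Y_coeff m x) i) \<theta> = fps_value \<Omega> \<theta> ^ (\<Sum>j=1..p. m j) * Li_term p m x i"
proof -
  have c: "twisted k (Y_coeff m x j) \<in> convergent_at \<theta>" for k j
    using geom_bounded_twist[OF geom_bounded_Y, of "q ^ k"] decay_bounds by (intro geom_bounded_convergent_at) auto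
  have v: "fps_value (twisted k (Y_coeff m x j)) \<theta> = (fps_value \<Omega> \<theta> / carlitz_L q \<theta> k) ^ m j * x j ^ q ^ k" for k j
    unfolding Y_coeff_def twisted_mult twisted_power twisted_const
    by (simp add: convergent_at_mult convergent_at_power convergent_at_twisted_Omega fps_value_twisted_Omega)
  have "fps_value (tuple_term p (Y_coeff m x) i) \<theta> = (\<Prod>j=1..p. fps_value (twisted (i j) (Y_coeff m x j)) \<theta>)"
    unfolding tuple_term_def using convergent_at_prod[of "{1..p}" "\<lambda>j. twisted (i j) (Y_coeff m x j)"] c by blast
  also have "\<dots> = (\<Prod>j=1..p. fps_value \<Omega> \<theta> ^ m j * (x j ^ q ^ i j / carlitz_L q \<theta> (i j) ^ m j))"
    unfolding v by (intro prod.cong) (auto simp: power_divide)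
  also have "\<dots> = fps_value \<Omega> \<theta> ^ (\<Sum>j=1..p. m j) * Li_term p m x i"
    by (simp only: prod.distrib power_sum Li_term_def)
  finally show ?thesis .
qed

lemma carlitz_Li_has_sum:
  assumes "vanishing q p (Y_bound m x)"
  shows "(Li_term p m x has_sum carlitz_Li q \<theta> p m x) (increasing_tuples p)"
    and "fps_value (tuple_series p (Y_coeff m x)) \<theta> = fps_value \<Omega> \<theta> ^ (\<Sum>j=1..p. m j) * carlitz_Li q \<theta> p m x"
proof -
  let ?s = "fps_value \<Omega> \<theta> ^ (\<Sum>j=1..p. m j)"
  have hs: "((\<lambda>i. ?s * Li_term p m x i) has_sum fps_value (tuple_series p (Y_coeff m x)) \<theta>) (increasing_tuples p)"
    using tuple_series_value[OF geom_bounded_Y assms] by (simp add: fps_value_tuple_term)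
  have s: "?s \<noteq> 0" using fps_value_Omega_neq_0 by simp
  have *: "(Li_term p m x has_sum (inverse ?s * fps_value (tuple_series p (Y_coeff m x)) \<theta>)) (increasing_tuples p)"
    using has_sum_mult_left[OF hs, of "inverse ?s"] s by (simp flip: mult.assoc)
  then have L: "carlitz_Li q \<theta> p m x = inverse ?s * fps_value (tuple_series p (Y_coeff m x)) \<theta>"
    unfolding carlitz_Li_def Li_term_def[symmetric] by (rule infsumI)
  show "(Li_term p m x has_sum carlitz_Li q \<theta> p m x) (increasing_tuples p)"
    using * L by simp
  show "fps_value (tuple_series p (Y_coeff m x)) \<theta> = ?s * carlitz_Li q \<theta> p m x"
    using s by (simp add: L)
qed

text \<open>The last argument is set to 1 because it contributes exactly the monomial
  \<open>u^(q^(i p))\<close>; the coefficient collects the finitely many tuples with that exponent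
  and vanishes unless k is a power of q.\<close>

definition Li_coeff :: "nat \<Rightarrow> (nat \<Rightarrow> nat) \<Rightarrow> (nat \<Rightarrow> 'c) \<Rightarrow> nat \<Rightarrow> 'c" where
  "Li_coeff p m x k = (\<Sum>i\<in>{i \<in> increasing_tuples p. q ^ i p = k}. Li_term p m (x(p := 1)) i)"

text \<open>Every tuple lies in exactly one of the sets with fixed \<open>q ^ i p\<close>, so
  grouping the unconditional sum by this exponent gives a power series in the last argument.\<close>

lemma carlitz_Li_power_series:
  assumes p: "p \<ge> 1" and van: "vanishing q p (Y_bound m (x(p := u)))"
  shows "(\<lambda>k. Li_coeff p m x k * u ^ k) sums carlitz_Li q \<theta> p m (x(p := u))"
proof -
  let ?F = "\<lambda>k. {i \<in> increasing_tuples p. q ^ i p = k}"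
  have fin: "finite (?F k)" for k
  proof (rule finite_subset[OF _ finite_increasing_tuples_bounded])
    have "i p \<le> q ^ i p" for i :: "nat \<Rightarrow> nat"
      using less_exp[of "i p"] power_mono[of 2 q "i p"] q_ge_2 by linarith
    then show "?F k \<subseteq> {i \<in> increasing_tuples p. i p \<le> k}" by auto
  qed
  have "(Li_term p m (x(p := u)) has_sum carlitz_Li q \<theta> p m (x(p := u))) (increasing_tuples p)"
    using carlitz_Li_has_sum(1)[OF van] .
  then have "((\<lambda>(k, i). Li_term p m (x(p := u)) i) has_sum carlitz_Li q \<theta> p m (x(p := u))) (Sigma UNIV ?F)"
    by (subst has_sum_reindex_bij_witness[where T = "increasing_tuples p" and s' = "carlitz_Li q \<theta> p m (x(p := u))"
          and i = "\<lambda>i. (q ^ i p, i)" and j = snd and h = "Li_term p m (x(p := u))"]) auto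
  then have "((\<lambda>k. \<Sum>i\<in>?F k. Li_term p m (x(p := u)) i) has_sum carlitz_Li q \<theta> p m (x(p := u))) UNIV"
    by (rule has_sum_SigmaD) (simp add: fin)
  moreover have "(\<Sum>i\<in>?F k. Li_term p m (x(p := u)) i) = Li_coeff p m x k * u ^ k" for k
  proof -
    have "Li_term p m (x(p := u)) i = Li_term p m (x(p := 1)) i * u ^ (q ^ i p)" for i
    proof -
      have split: "{1..p} = insert p {1..<p}" using p by auto
      show ?thesis unfolding Li_term_def split by simp
    qed
    then show ?thesis unfolding Li_coeff_def sum_distrib_right by (intro sum.cong) auto
  qed
  ultimately show ?thesis by (intro has_sum_imp_sums) simp
qed

end

section \<open>Explicit solutions\<close>

context monodromy_setting
begin

text \<open>Equation p multiplies by the coefficient with index d-p+1, so unrolling the recursion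
  brings in the indices d-p+1 to d: entry p is the series of the last p arguments.\<close>

definition series_solution :: "(nat \<Rightarrow> 'c) \<Rightarrow> nat \<Rightarrow> 'c fps" where
  "series_solution x p = tuple_series p (Y_coeff (\<lambda>j. n (d - p + j)) (\<lambda>j. x (d - p + j)))"

text \<open>Each entry of \<open>series_solution\<close> needs its own convergence: a vanishing
  argument can make the full series trivial while a shorter tail diverges.\<close>

definition tails_vanish :: "(nat \<Rightarrow> 'c) \<Rightarrow> bool" where
  "tails_vanish x \<longleftrightarrow> (\<forall>p\<in>{1..d}. vanishing q p (Y_bound (\<lambda>j. n (d - p + j)) (\<lambda>j. x (d - p + j))))"

lemma tails_vanishD:
  "tails_vanish x \<Longrightarrow> p \<le> d \<Longrightarrow> vanishing q p (Y_bound (\<lambda>j. n (d - p + j)) (\<lambda>j. x (d - p + j)))"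
  by (cases "p = 0") (auto simp: tails_vanish_def vanishing_def increasing_tuples_0)

lemma series_solution_0: "series_solution x 0 = 1"
  by (simp add: series_solution_def tuple_series_0)

lemma series_solution_convergent:
  "tails_vanish x \<Longrightarrow> p \<le> d \<Longrightarrow> series_solution x p \<in> convergent_at \<theta>"
  unfolding series_solution_def by (rule tuple_series_convergent[OF geom_bounded_Y tails_vanishD])

lemma wp_series_solution:
  assumes x: "tails_vanish x" and p: "p \<in> {1..d}"
  shows "wp q (series_solution x p) = Ys x (d - p + 1) * twist q (series_solution x (p - 1))"
proof -
  obtain p' where p': "p = Suc p'" using p by (cases p) auto
  let ?n = "\<lambda>j. n (d - p + j)" and ?x = "\<lambda>j. x (d - p + j)"
  have idx: "d - p + Suc j = d - p' + j" for j using p p' by auto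
  have sh: "(\<lambda>j. Y_coeff ?n ?x (Suc j)) = Y_coeff (\<lambda>j. n (d - p' + j)) (\<lambda>j. x (d - p' + j))"
    "(\<lambda>j. Y_bound ?n ?x (Suc j)) = Y_bound (\<lambda>j. n (d - p' + j)) (\<lambda>j. x (d - p' + j))"
    by (simp_all only: fun_eq_iff Y_coeff_def Y_bound_def idx simp_thms)
  have "wp q (tuple_series (Suc p') (Y_coeff ?n ?x))
      = Y_coeff ?n ?x 1 * twist q (tuple_series p' (\<lambda>j. Y_coeff ?n ?x (Suc j)))"
  proof (rule wp_tuple_series[OF geom_bounded_Y])
    show "vanishing q (Suc p') (Y_bound ?n ?x)"
      using tails_vanishD[OF x, of p] p by (simp only: p' atLeastAtMost_iff)
    show "vanishing q p' (\<lambda>j. Y_bound ?n ?x (Suc j))"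
      unfolding sh using p p' by (intro tails_vanishD[OF x]) auto
  qed
  moreover have "Y_coeff ?n ?x 1 = Ys x (d - p + 1)"
    by (simp add: Y_coeff_def system_coeffs_def)
  ultimately show ?thesis
    unfolding sh by (simp add: series_solution_def p')
qed

lemma solves_system_series:
  assumes "tails_vanish x"
  shows "solves_system q d (Ys x) (series_solution x)"
  unfolding solves_system_def
  using assms by (auto simp: series_solution_0 wp_series_solution
      intro!: convergent_at_theta_tate series_solution_convergent)

text \<open>The last p exponents of the weight cancel against the powers of
  \<open>fps_value \<Omega> \<theta>\<close> carried by the series; what is left is the power of
  \<open>\<pi>\<close> in front of the polylogarithm.\<close>

lemma weight_split:
  assumes "p \<le> d"
  shows "\<pi> ^ w * (fps_value \<Omega> \<theta> ^ (\<Sum>j=1..p. n (d - p + j)) * l) = \<pi> ^ (\<Sum>i=1..d-p. n i) * l"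
proof -
  have "w = (\<Sum>i=1..d-p. n i) + (\<Sum>i=d-p+1..d-p+p. n i)"
    using sum.ub_add_nat[of 1 "d - p" n p] assms by simp
  also have "(\<Sum>i=d-p+1..d-p+p. n i) = (\<Sum>j=1..p. n (d - p + j))"
    using sum.shift_bounds_cl_nat_ivl[of n 1 "d - p" p] by (simp add: add.commute)
  finally have w: "w = (\<Sum>i=1..d-p. n i) + (\<Sum>j=1..p. n (d - p + j))" .
  have "\<pi> * fps_value \<Omega> \<theta> = 1" using fps_value_Omega_neq_0 by (simp add: pi_tilde_def)
  then have "\<pi> ^ k * fps_value \<Omega> \<theta> ^ k = 1" for k by (simp flip: power_mult_distrib)
  then have "\<pi> ^ a * \<pi> ^ k * (fps_value \<Omega> \<theta> ^ k * l) = \<pi> ^ a * l" for a k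
    by (metis mult.assoc mult.left_neutral)
  then show ?thesis unfolding w power_add .
qed

lemma series_solution_value:
  assumes "tails_vanish x" "p \<le> d"
  shows "\<pi> ^ w * fps_value (series_solution x p) \<theta> =
     \<pi> ^ (\<Sum>i=1..d-p. n i) * carlitz_Li q \<theta> p (\<lambda>j. n (d - p + j)) (\<lambda>j. x (d - p + j))"
  unfolding series_solution_def carlitz_Li_has_sum(2)[OF tails_vanishD[OF assms]]
  by (rule weight_split[OF assms(2)])

lemma Li_class_series:
  assumes x: "z(d := zd) \<in> convergence_region q d n"
    and tails: "\<And>p. p \<in> {1..<d} \<Longrightarrow>
      (\<lambda>j. (z(d := zd)) (d - p + j)) \<in> convergence_region q p (\<lambda>j. n (d - p + j))"
  shows "Li_class q \<theta> \<rho> d n (z(d := zd)) M = coset d M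
     (\<lambda>p\<in>{1..d}. \<pi> ^ (\<Sum>i=1..d-p. n i) *
        carlitz_Li q \<theta> p (\<lambda>j. n (d - p + j)) (\<lambda>j. (z(d := zd)) (d - p + j)))"
proof -
  have tv: "tails_vanish (z(d := zd))"
    unfolding tails_vanish_def vanishing_Y_bound_iff
  proof
    fix p assume "p \<in> {1..d}"
    then consider "p \<in> {1..<d}" | "p = d" by fastforce
    then show "(\<lambda>j. (z(d := zd)) (d - p + j)) \<in> convergence_region q p (\<lambda>j. n (d - p + j))"
    proof cases
      case 1
      then show ?thesis by (rule tails)
    next
      case 2
      then show ?thesis using x by (simp add: fun_upd_def)
    qed
  qed
  show ?thesis
  proof (rule Li_class_eq[OF solves_system_series[OF tv]])
    fix p assume p: "p \<in> {1..d}"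
    then have "p \<le> d" by simp
    show "(\<lambda>p\<in>{1..d}. \<pi> ^ (\<Sum>i=1..d-p. n i) *
        carlitz_Li q \<theta> p (\<lambda>j. n (d - p + j)) (\<lambda>j. (z(d := zd)) (d - p + j))) p =
        \<pi> ^ w * fps_value (series_solution (z(d := zd)) p) \<theta>"
      unfolding restrict_apply'[OF p] series_solution_value[OF tv \<open>p \<le> d\<close>] ..
  qed
qed

text \<open>Only the first equation of the system involves \<open>z\<^sub>d\<close>, and it does so linearly.\<close>

lemma solves_system_perturb:
  assumes F: "solves_system q d (Ys (z(d := z0))) F" and u: "tails_vanish (z(d := u))"
  shows "solves_system q d (Ys (z(d := z0 + u)))
    (\<lambda>p. F p + (if p = 0 then 0 else series_solution (z(d := u)) p))"
  unfolding solves_system_def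
proof (intro conjI ballI)
  \<comment> \<open>\<open>series_solution\<close> starts with 1, but the start value of the sum
    must remain 1, so entry 0 is replaced by 0. In the equation with i = 1 the two start values 1
    multiply the coefficients for \<open>z0\<close> and \<open>u\<close>, which add up to the
    coefficient for \<open>z0 + u\<close>.\<close>
  let ?E = "\<lambda>p. if p = 0 then 0 else series_solution (z(d := u)) p"
  show "F 0 + ?E 0 = 1" using F by (simp add: solves_system_def)
  fix i assume i: "i \<in> {1..d}"
  then have Fi: "F i \<in> convergent_at \<theta>" "wp q (F i) = Ys (z(d := z0)) (d - i + 1) * twist q (F (i - 1))"
    using solution_convergent[OF F] F by (auto simp: solves_system_def)
  have S: "series_solution (z(d := u)) i \<in> convergent_at \<theta>"
    using i by (intro series_solution_convergent[OF u]) auto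
  show "F i + ?E i \<in> tate_algebra"
    using Fi S i by (intro convergent_at_theta_tate) (auto intro: convergent_at_add(1))
  have tw: "twist q (f + g) = twist q f + twist q g" for f g :: "'c fps"
    using twisted_add[of 1 f g] by simp
  have wp_add: "wp q (f + g) = wp q f + wp q g" for f g :: "'c fps"
    by (simp add: wp_def tw)
  have Ei: "?E i = series_solution (z(d := u)) i" using i by simp
  have "wp q (F i + ?E i) = Ys (z(d := z0)) (d - i + 1) * twist q (F (i - 1))
      + Ys (z(d := u)) (d - i + 1) * twist q (series_solution (z(d := u)) (i - 1))"
    by (simp only: Ei wp_add Fi(2) wp_series_solution[OF u i])
  also have "\<dots> = Ys (z(d := z0 + u)) (d - i + 1) * twist q (F (i - 1) + ?E (i - 1))"
  proof (cases "i = 1")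
    case True
    then show ?thesis
      using F i twisted_1[of 1]
      by (simp add: solves_system_def series_solution_0 system_coeffs_def flip: fps_const_add distrib_left)
  next
    case False
    then have "d - i + 1 \<noteq> d" "i - 1 \<noteq> 0" using i by auto
    then show ?thesis by (simp add: system_coeffs_def tw distrib_left)
  qed
  finally show "wp q (F i + ?E i) = Ys (z(d := z0 + u)) (d - i + 1) * twist q (F (i - 1) + ?E (i - 1))" .
qed

section \<open>Local analyticity in the last argument\<close>

lemma tail_last:
  assumes "p \<in> {1..d}"
  shows "(\<lambda>j. (z(d := u)) (d - p + j)) = (\<lambda>j. z (d - p + j))(p := u)"
  using assms by (auto simp: fun_eq_iff)

text \<open>The choice of \<open>a\<close> makes \<open>B * b p\<close> at most 1/q, so
  \<open>tuple_product_le\<close> bounds every term by 1/q. This gives the convergence of all tails,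
  and the bound survives evaluation at \<open>\<theta>\<close> because
  \<open>decay * absval \<theta> < 1\<close>.\<close>

lemma small_argument:
  obtains a :: 'c where "a \<noteq> 0"
    "\<And>u. absval u \<le> absval a \<Longrightarrow> tails_vanish (z(d := u))"
    "\<And>u p. absval u \<le> absval a \<Longrightarrow> p \<in> {1..d} \<Longrightarrow>
       absval (fps_value (series_solution (z(d := u)) p) \<theta>) \<le> inverse (real q)"
proof -
  \<comment> \<open>The sum is a crude common bound for the fixed arguments; 1 is added because
    \<open>tuple_product_le\<close> asks for \<open>B \<ge> 1\<close>.\<close>
  define B where "B = 1 + (\<Sum>j\<le>d. Y_bound n z j)"
  have B: "Y_bound n z j \<le> B" if "j \<le> d" for j
  proof -
    have "Y_bound n z j \<le> (\<Sum>j\<le>d. Y_bound n z j)"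
      using that by (intro member_le_sum) (auto simp: Y_bound_nonneg)
    then show ?thesis by (simp add: B_def)
  qed
  have B1: "B \<ge> 1" unfolding B_def by (simp add: sum_nonneg Y_bound_nonneg)
  have \<omega>0: "\<omega> ^ n d > 0" by (simp add: \<omega>_def)
  define e where "e = inverse (B * \<omega> ^ n d * real q)"
  have e0: "e > 0" using B1 \<omega>0 q_gt_1 by (simp add: e_def)
  have "inverse (real q) < 1" using q_gt_1 by (simp add: inverse_less_1_iff)
  then obtain N where N: "inverse (real q) ^ N < e"
    using real_arch_pow_inv[OF e0] by blast
  \<comment> \<open>Radii of disks are absolute values of elements, hence a power of
    \<open>inverse \<theta>\<close> below the threshold \<open>e\<close>.\<close>
  define a where "a = inverse \<theta> ^ N"
  have aa: "absval a < e" using N by (simp add: a_def absval_power absval_inverse absval_theta)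
  have key: "vanishing q p b \<and> (\<forall>i\<in>increasing_tuples p. (\<Prod>j=1..p. b j ^ q ^ i j) \<le> inverse (real q))"
    if u: "absval u \<le> absval a" and p: "p \<in> {1..d}"
      and b: "b = Y_bound (\<lambda>j. n (d - p + j)) (\<lambda>j. (z(d := u)) (d - p + j))" for u p b
  proof -
    have p1: "p \<ge> 1" using p by simp
    have bj: "b j \<le> B" if "j \<in> {1..<p}" for j
    proof -
      have "d - p + j \<noteq> d" "d - p + j \<le> d" using that p by auto
      then show ?thesis using B[of "d - p + j"] by (simp add: b Y_bound_def)
    qed
    have b0: "b j \<ge> 0" for j by (simp add: b Y_bound_nonneg)
    have "b p = absval u * \<omega> ^ n d" using p by (simp add: b Y_bound_def)
    also have "\<dots> \<le> e * \<omega> ^ n d" using u aa \<omega>0 by (intro mult_right_mono) auto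
    finally have "B * b p \<le> B * (e * \<omega> ^ n d)" using B1 by (intro mult_left_mono) auto
    also have "\<dots> = inverse (real q)" using B1 q_gt_1 by (simp add: e_def \<omega>_def field_simps)
    finally have c: "B * b p \<le> inverse (real q)" .
    then have c1: "B * b p < 1" using \<open>inverse (real q) < 1\<close> by linarith
    have "(\<Prod>j=1..p. b j ^ q ^ i j) \<le> inverse (real q)" if i: "i \<in> increasing_tuples p" for i
    proof -
      have "(\<Prod>j=1..p. b j ^ q ^ i j) \<le> (B * b p) ^ q ^ i p"
        using i p1 q_ge_2 bj b0 B1 by (rule tuple_product_le)
      also have "\<dots> \<le> (B * b p) ^ 1"
        using b0 B1 c1 q_gt_1 by (intro power_decreasing) (auto intro: one_le_power)
      finally show ?thesis using c by simp
    qed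
    moreover have "vanishing q p b"
      using p1 q_ge_2 bj b0 B1 c1 by (rule vanishing_small_last)
    ultimately show ?thesis by blast
  qed
  show thesis
  proof
    show "a \<noteq> 0" by (simp add: a_def)
    show tv: "tails_vanish (z(d := u))" if "absval u \<le> absval a" for u
      unfolding tails_vanish_def using key[OF that _ refl] by blast
    fix u :: 'c and p assume u: "absval u \<le> absval a" and p: "p \<in> {1..d}"
    have g: "geom_bounded decay (inverse (real q)) (series_solution (z(d := u)) p)"
      unfolding series_solution_def
      using key[OF u p refl] by (intro tuple_series_bound[OF geom_bounded_Y]) auto
    show "absval (fps_value (series_solution (z(d := u)) p) \<theta>) \<le> inverse (real q)"
    proof (rule has_sum_absval_le[OF fps_value_has_sum])
      show "series_solution (z(d := u)) p \<in> convergent_at \<theta>"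
        using p by (intro series_solution_convergent tv u) auto
      fix k
      have "absval (fps_nth (series_solution (z(d := u)) p) k * \<theta> ^ k) \<le> inverse (real q) * decay ^ k * absval \<theta> ^ k"
        using g unfolding absval_mult absval_power geom_bounded_def by (intro mult_right_mono) auto
      also have "\<dots> = inverse (real q) * (decay * absval \<theta>) ^ k" by (simp add: power_mult_distrib)
      also have "\<dots> \<le> inverse (real q)"
        using decay_bounds by (intro mult_left_le power_le_one) auto
      finally show "absval (fps_nth (series_solution (z(d := u)) p) k * \<theta> ^ k) \<le> inverse (real q)" .
    qed simp
  qed
qed

lemma series_solution_value_sums:
  assumes u: "tails_vanish (z(d := u))" and p: "p \<in> {1..d}"
  shows "(\<lambda>k. \<pi> ^ (\<Sum>i=1..d-p. n i) * Li_coeff p (\<lambda>j. n (d - p + j)) (\<lambda>j. z (d - p + j)) k * u ^ k)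
     sums (\<pi> ^ w * fps_value (series_solution (z(d := u)) p) \<theta>)"
proof -
  let ?n = "\<lambda>j. n (d - p + j)" and ?z = "\<lambda>j. z (d - p + j)" and ?c = "\<pi> ^ (\<Sum>i=1..d-p. n i)"
  have "(\<lambda>k. Li_coeff p ?n ?z k * u ^ k) sums carlitz_Li q \<theta> p ?n (?z(p := u))"
    using tails_vanishD[OF u, of p] p unfolding tail_last[OF p] by (intro carlitz_Li_power_series) auto
  then have "(\<lambda>N. ?c * (\<Sum>k<N. Li_coeff p ?n ?z k * u ^ k)) \<longlonglongrightarrow> ?c * carlitz_Li q \<theta> p ?n (?z(p := u))"
    unfolding sums_def by (intro tendsto_mult tendsto_const)
  moreover have "p \<le> d" using p by simp
  ultimately show ?thesis
    unfolding sums_def series_solution_value[OF u \<open>p \<le> d\<close>] tail_last[OF p]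
    by (simp only: sum_distrib_left mult.assoc)
qed

text \<open>V is centred at the value of one solution at \<open>z0\<close>. Its radius
  \<open>absval (\<pi> ^ w / \<theta>)\<close> is \<open>absval (\<pi> ^ w) / q\<close>: large
  enough for the perturbation bounded in \<open>small_argument\<close>, and small enough for
  \<open>inj_on_coset_polydisk\<close>.\<close>

lemma Li_class_locally_analytic:
  "\<exists>U V g. closed_disk U \<and> z0 \<in> U \<and> closed_polydisk d V \<and> inj_on (coset d M) V \<and>
     (\<forall>zd\<in>U. g zd \<in> V \<and> Li_class q \<theta> \<rho> d n (z(d := zd)) M = coset d M (g zd)) \<and>
     (\<forall>p\<in>{1..d}. rigid_analytic_on U (\<lambda>zd. g zd p))"
proof -
  obtain a :: 'c where a: "a \<noteq> 0"
    and tv: "\<And>u. absval u \<le> absval a \<Longrightarrow> tails_vanish (z(d := u))"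
    and bd: "\<And>u p. absval u \<le> absval a \<Longrightarrow> p \<in> {1..d} \<Longrightarrow>
       absval (fps_value (series_solution (z(d := u)) p) \<theta>) \<le> inverse (real q)"
    by (rule small_argument) (rule that)
  obtain F where F: "solves_system q d (Ys (z(d := z0))) F"
    using solution_exists[of d "Ys (z(d := z0))"] by auto
  define c where "c p = \<pi> ^ w * fps_value (F p) \<theta>" for p
  define S where "S u p = \<pi> ^ w * fps_value (series_solution (z(d := u)) p) \<theta>" for u p
  define U where "U = cball z0 (absval a)"
  define V where "V = (\<Pi>\<^sub>E p\<in>{1..d}. cball (c p) (absval (\<pi> ^ w / \<theta>)))"
  define g where "g zd = (\<lambda>p\<in>{1..d}. c p + S (zd - z0) p)" for zd
  have U_iff: "zd \<in> U \<longleftrightarrow> absval (zd - z0) \<le> absval a" for zd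
    by (simp add: U_def dist_absval absval_minus_commute)
  have "closed_disk U"
    unfolding closed_disk_def U_def by (intro exI[of _ z0] exI[of _ a]) (simp add: a)
  moreover have "z0 \<in> U" by (simp add: U_iff)
  moreover have "closed_polydisk d V"
    unfolding closed_polydisk_def V_def
    by (intro exI[of _ c] exI[of _ "\<lambda>_. \<pi> ^ w / \<theta>"]) (simp add: pi_tilde_neq_0)
  moreover have "inj_on (coset d M) V"
    unfolding V_def
  proof (rule inj_on_coset_polydisk)
    show "absval (\<pi> ^ w / \<theta>) < absval (\<pi> ^ w)"
      using q_gt_1 pi_tilde_neq_0 by (simp add: absval_divide absval_theta absval_power divide_less_eq)
  qed
  moreover have "g zd \<in> V" if zd: "zd \<in> U" for zd
  proof -
    have "absval (S (zd - z0) p) \<le> absval (\<pi> ^ w / \<theta>)" if "p \<in> {1..d}" for p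
      using mult_left_mono[OF bd[of "zd - z0" p], of "absval (\<pi> ^ w)"] that zd
      by (simp add: S_def U_iff absval_mult absval_inverse absval_theta divide_inverse)
    then show ?thesis by (auto simp: g_def V_def dist_absval)
  qed
  moreover have "Li_class q \<theta> \<rho> d n (z(d := zd)) M = coset d M (g zd)" if zd: "zd \<in> U" for zd
  proof -
    let ?u = "zd - z0"
    have tvu: "tails_vanish (z(d := ?u))" using zd by (intro tv) (simp add: U_iff)
    have "solves_system q d (Ys (z(d := zd))) (\<lambda>p. F p + (if p = 0 then 0 else series_solution (z(d := ?u)) p))"
      using solves_system_perturb[OF F tvu] by simp
    then show ?thesis
    proof (rule Li_class_eq)
      fix p assume p: "p \<in> {1..d}"
      then have "fps_value (F p + series_solution (z(d := ?u)) p) \<theta> =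
          fps_value (F p) \<theta> + fps_value (series_solution (z(d := ?u)) p) \<theta>"
        by (intro convergent_at_add(2) solution_convergent[OF F] series_solution_convergent tvu) auto
      then show "g zd p = \<pi> ^ w * fps_value (F p + (if p = 0 then 0 else series_solution (z(d := ?u)) p)) \<theta>"
        using p by (simp add: g_def c_def S_def distrib_left)
    qed
  qed
  moreover have "rigid_analytic_on U (\<lambda>zd. g zd p)" if p: "p \<in> {1..d}" for p
  proof -
    \<comment> \<open>The value of the fixed solution goes into the coefficient of degree 0.\<close>
    define \<beta> where "\<beta> k = \<pi> ^ (\<Sum>i=1..d-p. n i) * Li_coeff p (\<lambda>j. n (d - p + j)) (\<lambda>j. z (d - p + j)) k
      + (if k = 0 then c p else 0)" for k
    have sums: "(\<lambda>k. \<beta> k * u ^ k) sums (c p + S u p)" if u: "absval u \<le> absval a" for u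
    proof -
      have "(\<lambda>k. if k = 0 then c p else 0) sums c p"
        using sums_single[of 0 "\<lambda>_. c p"] by simp
      from sums_add[OF this series_solution_value_sums[OF tv[OF u] p]] show ?thesis
        unfolding S_def \<beta>_def by (rule back_subst[of "\<lambda>f. f sums _"]) (auto simp: fun_eq_iff algebra_simps)
    qed
    \<comment> \<open>The series converges at the boundary point \<open>u = a\<close> too, which is
      the condition for analyticity on the closed disk.\<close>
    have "(\<lambda>k. \<beta> k * a ^ k) \<longlonglongrightarrow> 0" using sums_imp_null[OF sums[of a]] by simp
    moreover have "\<forall>x\<in>U. (\<lambda>k. \<beta> k * (x - z0) ^ k) sums g x p"
      using p by (auto simp: g_def U_iff intro: sums)
    ultimately show ?thesis
      unfolding rigid_analytic_on_def using a U_def by blast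
  qed
  ultimately show ?thesis by blast
qed

end

text \<open>The condition on the tails expresses that the shorter series in the vector converge. By
  \<open>convergence_region_tail\<close> it follows from
  \<open>x \<in> convergence_region q d n\<close> whenever the first d-1 arguments are
  nonzero.\<close>

theorem theorem1p10:
  fixes \<iota> :: "'f::{field,finite} fls \<Rightarrow> 'c::complete_nonarch_field"
    and q d :: nat and \<theta> \<rho> :: 'c
    and n :: "nat \<Rightarrow> nat" and z :: "nat \<Rightarrow> 'c"
    and G :: "nat \<Rightarrow> nat \<Rightarrow> 'c fps" and M :: "(nat \<Rightarrow> 'c) set"
  assumes "is_C_infinity \<iota>"
    and "q = CARD('f)" and "\<theta> = \<iota> fls_X_inv"
    and "\<rho> ^ (q - 1) = - \<theta>"
    and "d \<ge> 1"
    and "\<forall>k<d. solves_system q k (system_coeffs q \<theta> \<rho> n z) (G k)"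
    and "M = monodromy_module \<iota> \<rho> d n G"
  shows
    "(\<forall>zd x. x = z(d := zd) \<longrightarrow>
        x \<in> convergence_region q d n \<longrightarrow>
        (\<forall>p\<in>{1..<d}. (\<lambda>j. x (d - p + j)) \<in> convergence_region q p (\<lambda>j. n (d - p + j))) \<longrightarrow>
        Li_class q \<theta> \<rho> d n x M =
          coset d M
            (\<lambda>p\<in>{1..d}. pi_tilde q \<theta> \<rho> ^ (\<Sum>i=1..d-p. n i) *
                        carlitz_Li q \<theta> p (\<lambda>j. n (d - p + j)) (\<lambda>j. x (d - p + j))))
     \<and>
     (\<forall>z0. \<exists>U V g.
        closed_disk U \<and> z0 \<in> U \<and>
        closed_polydisk d V \<and> inj_on (coset d M) V \<and>
        (\<forall>zd\<in>U. g zd \<in> V \<and> Li_class q \<theta> \<rho> d n (z(d := zd)) M = coset d M (g zd)) \<and>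
        (\<forall>p\<in>{1..d}. rigid_analytic_on U (\<lambda>zd. g zd p)))"
proof -
  interpret monodromy_setting \<iota> q \<theta> \<rho> d n z G M
    by unfold_locales (use assms in auto)
  show ?thesis
    using Li_class_series Li_class_locally_analytic by blast
qed

end
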